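(* Let $f$ be a minor-monotone graph parameter which is $(c,r)$-bounded from below by a function $\widetilde{f}$ for some $c>1$ and $r\ge 0$. Let $C\ge 10c$ and let $p=p(n)$ satisfy $0<p\le 2/n$ and $n^2p=\omega(1)$. Let $H$ be an $n$-vertex connected graph with maximum degree $\Delta$ such that $1\le \Delta\le n^2p/(9600C)$. Let $G=G(n,p)$ be on the vertex set $V(H)$ and $R:=H\cup G$. Put $L=19200\,C\Delta$ and $M=(96C\Delta)^2 n^{-2}p^{-1}$. Then with high probability \[ f(R)\ \ge\ \begin{cases} r\cdot \widetilde f\!\left(n^2pL^{-1},\ 1-e^{-M}\right) & \text{if } \Delta\le \sqrt{n^2p\log(n^2p)},\\[2pt] f\!\left(K_{n^2pL^{-1}}\right) & \text{otherwise},\end{cases} \] where $K_t$ denotes the complete graph on $t$ vertices.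
   Context: All graphs are finite, simple and undirected. $G(n,p)$ is the binomial random graph on $n$ vertices in which each pair is an edge independently with probability $p$. Asymptotics are as $n\to\infty$; $x=o(1)$ means $x\to 0$, $y=\omega(1)$ means $y\to\infty$; an event holds with high probability (whp) if it holds with probability $1-o(1)$. $\log$ is the natural logarithm. A graph parameter $f$ is minor-monotone if $f(H)\le f(G)$ whenever $H$ is a minor of $G$. Given $c,r>0$ (or $r\ge0$) and a function $\widetilde f:\mathbb N\times[0,1]\to\mathbb R_{\ge 0}$, $f$ is $(c,r)$-bounded from below by $\widetilde f$ if for every $p=p(n)\in[c/n,1]$, with probability $1-o(1)$ we have $f(G(n,p))\ge r\cdot\widetilde f(n,p)$. For the union $H\cup G$, both graphs are on the same vertex set. *)

theory Defs
  imports "HOL-Probability.Probability"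
begin

type_synonym ugraph = "nat set \<times> nat set set"

definition is_graph :: "ugraph \<Rightarrow> bool" where
  "is_graph G \<longleftrightarrow> finite (fst G) \<and>
     (\<forall>e\<in>snd G. \<exists>u v. e = {u, v} \<and> u \<noteq> v \<and> u \<in> fst G \<and> v \<in> fst G)"

definition connected_on :: "ugraph \<Rightarrow> nat set \<Rightarrow> bool" where
  "connected_on G S \<longleftrightarrow>
     (\<forall>u\<in>S. \<forall>v\<in>S. (\<lambda>x y. x \<in> S \<and> y \<in> S \<and> {x, y} \<in> snd G)\<^sup>*\<^sup>* u v)"

definition connected_graph :: "ugraph \<Rightarrow> bool" where
  "connected_graph G \<longleftrightarrow> is_graph G \<and> fst G \<noteq> {} \<and> connected_on G (fst G)"

definition is_minor :: "ugraph \<Rightarrow> ugraph \<Rightarrow> bool" where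
  "is_minor H G \<longleftrightarrow> (\<exists>\<phi> :: nat \<Rightarrow> nat set.
     (\<forall>v\<in>fst H. \<phi> v \<noteq> {} \<and> \<phi> v \<subseteq> fst G \<and> connected_on G (\<phi> v)) \<and>
     (\<forall>u\<in>fst H. \<forall>v\<in>fst H. u \<noteq> v \<longrightarrow> \<phi> u \<inter> \<phi> v = {}) \<and>
     (\<forall>u v. {u, v} \<in> snd H \<longrightarrow> (\<exists>x\<in>\<phi> u. \<exists>y\<in>\<phi> v. {x, y} \<in> snd G)))"

definition minor_monotone :: "(ugraph \<Rightarrow> real) \<Rightarrow> bool" where
  "minor_monotone f \<longleftrightarrow>
     (\<forall>G H. is_graph G \<longrightarrow> is_graph H \<longrightarrow> is_minor H G \<longrightarrow> f H \<le> f G)"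

definition degree :: "ugraph \<Rightarrow> nat \<Rightarrow> nat" where
  "degree G v = card {u. {v, u} \<in> snd G}"

definition max_degree :: "ugraph \<Rightarrow> nat" where
  "max_degree G = Max (degree G ` fst G)"

definition complete_graph :: "nat \<Rightarrow> ugraph" where
  "complete_graph t = ({..<t}, {e. \<exists>u v. e = {u, v} \<and> u \<noteq> v \<and> u < t \<and> v < t})"

definition graph_union :: "ugraph \<Rightarrow> ugraph \<Rightarrow> ugraph" where
  "graph_union H G = (fst H, snd H \<union> snd G)"

definition pairs :: "nat \<Rightarrow> nat set set" where
  "pairs n = {e. \<exists>u v. e = {u, v} \<and> u \<noteq> v \<and> u < n \<and> v < n}"

definition gnp :: "nat \<Rightarrow> real \<Rightarrow> ugraph pmf" where
  "gnp n p = map_pmf (\<lambda>b. ({..<n}, {e \<in> pairs n. b e}))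
                      (Pi_pmf (pairs n) False (\<lambda>_. bernoulli_pmf p))"

definition bounded_below :: "(ugraph \<Rightarrow> real) \<Rightarrow> real \<Rightarrow> real \<Rightarrow> (nat \<Rightarrow> real \<Rightarrow> real) \<Rightarrow> bool" where
  "bounded_below f c r ft \<longleftrightarrow>
     (\<forall>p :: nat \<Rightarrow> real. (\<forall>\<^sub>F n in sequentially. c / real n \<le> p n \<and> p n \<le> 1) \<longrightarrow>
        ((\<lambda>n. measure_pmf.prob (gnp n (p n)) {G. f G \<ge> r * ft n (p n)}) \<longlonglongrightarrow> 1))"

end

theory Submission
  imports Defs "HOL-Real_Asymp.Real_Asymp"
begin

text \<open>Write \<open>N = n\<^sup>2 p\<close> and \<open>\<kappa> = C/(n p)\<close>. A connected graph of maximum degree \<open>\<Delta>\<close> decomposes, up to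
  fewer than \<open>s\<close> vertices, into connected parts of sizes between \<open>s\<close> and \<open>\<Delta> s\<close>; take \<open>s \<approx> 8\<kappa>\<close>.
  Parts of sizes at least \<open>\<kappa>\<Delta>\<close> are wanted instead, and there may be too few of these in \<open>H\<close> alone (a
  spider with \<open>\<Delta>\<close> legs), so \<open>G(n,p)\<close> is exposed in two independent rounds of density at least \<open>p/2\<close>.
  There are at most \<open>N/80\<close> small parts, so by a union bound the first round joins any two disjoint
  families of parts covering \<open>n/4\<close> vertices each, with failure probability at most \<open>exp(-N/200)\<close>.
  Depth-first search then finds a path of parts covering nearly \<open>n/2\<close> vertices, and cutting it into
  segments gives \<open>\<lfloor>N/L\<rfloor>\<close> disjoint connected blocks of at least \<open>192\<kappa>\<Delta>\<close> vertices.
  The second round joins two given blocks with probability at least \<open>1 - exp(-M)\<close>, independently over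
  pairs of blocks, so \<open>R\<close> has a minor that stochastically dominates \<open>G(\<lfloor>N/L\<rfloor>, 1 - exp(-M))\<close>. If
  \<open>\<Delta>\<^sup>2 > N log N\<close>, that random graph is complete with high probability.\<close>

section \<open>Connected vertex sets\<close>

abbreviation walk :: "ugraph \<Rightarrow> nat set \<Rightarrow> nat \<Rightarrow> nat \<Rightarrow> bool" where
  "walk G S \<equiv> (\<lambda>x y. x \<in> S \<and> y \<in> S \<and> {x, y} \<in> snd G)\<^sup>*\<^sup>*"

lemma walk_sym:
  assumes "walk G S u v"
  shows "walk G S v u"
  using assms
proof (induction rule: rtranclp_induct)
  case (step y z)
  then show ?case
    by (intro converse_rtranclp_into_rtranclp[of _ z y]) (auto simp: insert_commute)
qed simp

lemma walk_mono:
  assumes "walk G S u v" "S \<subseteq> T" "snd G \<subseteq> snd G'"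
  shows "walk G' T u v"
proof -
  have "(\<lambda>x y. x \<in> S \<and> y \<in> S \<and> {x, y} \<in> snd G) \<le> (\<lambda>x y. x \<in> T \<and> y \<in> T \<and> {x, y} \<in> snd G')"
    using assms(2,3) by auto
  from rtranclp_mono[OF this] assms(1) show ?thesis by auto
qed

lemma walk_closed:
  assumes "walk G S u v" "u \<in> S"
  shows "v \<in> S"
  using assms by (induction rule: rtranclp_induct) auto

lemma connected_onD: "connected_on G S \<Longrightarrow> u \<in> S \<Longrightarrow> v \<in> S \<Longrightarrow> walk G S u v"
  by (auto simp: connected_on_def)

lemma connected_on_mono: "connected_on G S \<Longrightarrow> snd G \<subseteq> snd G' \<Longrightarrow> connected_on G' S"
  unfolding connected_on_def using walk_mono[OF _ order_refl] by blast

lemma connected_on_empty: "connected_on G {}"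
  by (simp add: connected_on_def)

lemma connected_on_singleton: "connected_on G {v}"
  by (simp add: connected_on_def)

lemma connected_on_walk_to:
  assumes "\<And>w. w \<in> S \<Longrightarrow> walk G S w v"
  shows "connected_on G S"
  unfolding connected_on_def
  by (intro ballI) (rule rtranclp_trans[OF assms walk_sym[OF assms]])

text \<open>Every point of \<open>S\<close> lies in a connected piece of \<open>S\<close> through
  \<open>v\<close>, so all walks can be routed via \<open>v\<close>. This form suits a set glued
  together from several pieces at one vertex.\<close>

lemma connected_on_center:
  assumes "\<And>w. w \<in> S \<Longrightarrow> \<exists>B\<subseteq>S. v \<in> B \<and> w \<in> B \<and> connected_on G B"
  shows "connected_on G S"
proof (rule connected_on_walk_to)
  fix w assume "w \<in> S"
  from assms[OF this] obtain B where B: "B \<subseteq> S" "v \<in> B" "w \<in> B" "connected_on G B" by blast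
  show "walk G S w v"
    by (rule walk_mono[OF connected_onD[OF B(4,3,2)] B(1) order_refl])
qed

lemma connected_on_Un:
  assumes "connected_on G A" "connected_on G B" "a \<in> A" "b \<in> B" "{a, b} \<in> snd G"
  shows "connected_on G (A \<union> B)"
proof (rule connected_on_walk_to)
  fix w assume w: "w \<in> A \<union> B"
  show "walk G (A \<union> B) w a"
  proof (cases "w \<in> A")
    case True
    show ?thesis
      by (rule walk_mono[OF connected_onD[OF assms(1) True assms(3)] Un_upper1 order_refl])
  next
    case False
    with w have "w \<in> B" by blast
    then have "walk G (A \<union> B) w b"
      by (intro walk_mono[OF connected_onD[OF assms(2) _ assms(4)] Un_upper2 order_refl])
    moreover have "b \<in> A \<union> B \<and> a \<in> A \<union> B \<and> {b, a} \<in> snd G"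
      using assms by (auto simp: insert_commute)
    ultimately show ?thesis by (rule rtranclp.rtrancl_into_rtrancl)
  qed
qed

text \<open>A walk inside \<open>S\<close> from \<open>A\<close> to \<open>S - A\<close> must leave
  \<open>A\<close>; the induction keeps the alternative that it is still in \<open>A\<close> or has
  already crossed an edge.\<close>

lemma connected_on_cut_edge:
  assumes "connected_on G S" "A \<subseteq> S" "A \<noteq> {}" "A \<noteq> S"
  obtains v z where "v \<in> A" "z \<in> S - A" "{v, z} \<in> snd G"
proof -
  obtain u w where u: "u \<in> A" and w: "w \<in> S - A" using assms by blast
  have "walk G S u w" using assms u w by (auto intro: connected_onD)
  then have "w \<in> A \<or> (\<exists>v\<in>A. \<exists>z\<in>S - A. {v, z} \<in> snd G)"
    using u by (induction rule: rtranclp_induct) auto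
  then show ?thesis using w that by blast
qed

text \<open>Take \<open>A\<close> minimal and \<open>v \<in> A\<close> adjacent to \<open>S - A\<close>. Removing a component \<open>K\<close> of \<open>A - {v}\<close> leaves
  \<open>S - K\<close> connected through \<open>v\<close>, so minimality forces \<open>card K < s\<close>, and there are at most \<open>\<Delta>\<close>
  components.\<close>

lemma ex_small_part:
  fixes s \<Delta> :: nat
  assumes S: "finite S" "connected_on G S" "s \<le> card S" and s: "1 \<le> s"
    and deg: "\<And>v. v \<in> S \<Longrightarrow> finite {u. {v, u} \<in> snd G} \<and> card {u. {v, u} \<in> snd G} \<le> \<Delta>"
  shows "\<exists>A\<subseteq>S. connected_on G A \<and> connected_on G (S - A) \<and> s \<le> card A \<and> card A \<le> 1 + \<Delta> * (s - 1)"
proof -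
  define Q where "Q A \<longleftrightarrow> A \<subseteq> S \<and> connected_on G A \<and> connected_on G (S - A) \<and> s \<le> card A" for A
  \<comment> \<open>The complement of \<open>S\<close> in itself is empty and hence connected, so
    \<open>S\<close> is a candidate and a smallest one exists.\<close>
  have "Q S" using S by (simp add: Q_def connected_on_empty)
  then obtain A where A: "Q A" and min: "\<And>B. Q B \<Longrightarrow> card A \<le> card B"
    using arg_min_nat_lemma[of Q S card] by blast
  have AS: "A \<subseteq> S" and cA: "connected_on G A" and cSA: "connected_on G (S - A)"
    and sA: "s \<le> card A" using A by (auto simp: Q_def)
  have finA: "finite A" using AS S(1) finite_subset by blast
  have "A \<noteq> {}" using sA s by auto
  obtain v where v: "v \<in> A" and vz: "S - A \<noteq> {} \<Longrightarrow> \<exists>z\<in>S - A. {v, z} \<in> snd G"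
  proof (cases "A = S")
    case True
    then show ?thesis using that \<open>A \<noteq> {}\<close> by blast
  next
    case False
    from connected_on_cut_edge[OF S(2) AS \<open>A \<noteq> {}\<close> False] show ?thesis using that by metis
  qed
  \<comment> \<open>For \<open>u\<close> in \<open>A - {v}\<close> this is the component of
    \<open>u\<close> in \<open>A - {v}\<close>. Since \<open>A\<close> is connected, each such
    component contains a neighbour of \<open>v\<close>, so those indexed by \<open>N\<close> exhaust
    \<open>A - {v}\<close>.\<close>
  define comp where "comp u = {w. walk G (A - {v}) u w}" for u
  define N where "N = {u \<in> A - {v}. {v, u} \<in> snd G}"
  have comp_sub: "comp u \<subseteq> A - {v}" if "u \<in> A - {v}" for u
    using walk_closed[OF _ that] unfolding comp_def by blast
  \<comment> \<open>Connectedness of \<open>comp u\<close> asks for walks that stay in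
    \<open>comp u\<close>, not merely in \<open>A - {v}\<close>. Every vertex along the given walk
    is itself reachable from \<open>u\<close>.\<close>
  have walk_comp: "walk G (comp u) u w" if "w \<in> comp u" "u \<in> A - {v}" for u w
  proof -
    have "walk G (A - {v}) u w" using that by (simp add: comp_def)
    then show ?thesis
    proof (induction rule: rtranclp_induct)
      case (step y z)
      have "y \<in> comp u" "z \<in> comp u"
        using step.hyps by (auto simp: comp_def intro: rtranclp.rtrancl_into_rtrancl)
      then show ?case using step by (auto intro: rtranclp.rtrancl_into_rtrancl)
    qed simp
  qed
  have comp_conn: "connected_on G (comp u)" if "u \<in> A - {v}" for u
    by (rule connected_on_walk_to[OF walk_sym[OF walk_comp[OF _ that]]])
  have comp_self: "u \<in> comp u" for u by (simp add: comp_def)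
  have cover: "\<exists>u\<in>N. w \<in> comp u" if w: "w \<in> A - {v}" for w
  proof -
    have "walk G A v w" using cA v w by (auto intro: connected_onD)
    then have "w = v \<or> (\<exists>u\<in>N. w \<in> comp u)"
    proof (induction rule: rtranclp_induct)
      case (step y z)
      show ?case
      proof (cases "z = v \<or> y = v")
        case True
        then show ?thesis using step comp_self[of z] by (auto simp: N_def)
      next
        case False
        then obtain u where u: "u \<in> N" "y \<in> comp u" using step by auto
        then have "z \<in> comp u"
          using step.hyps False by (auto simp: comp_def intro: rtranclp.rtrancl_into_rtrancl)
        then show ?thesis using u by blast
      qed
    qed simp
    then show ?thesis using w by blast
  qed
  have small: "card (comp u) \<le> s - 1" if u: "u \<in> N" for u
  proof (rule ccontr)
    assume "\<not> ?thesis"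
    then have big: "s \<le> card (comp u)" by simp
    have uA: "u \<in> A - {v}" using u by (simp add: N_def)
    have cu: "comp u \<subseteq> A - {v}" by (rule comp_sub[OF uA])
    have "connected_on G (S - comp u)"
    proof (rule connected_on_center[of _ v])
      fix w assume w: "w \<in> S - comp u"
      show "\<exists>B\<subseteq>S - comp u. v \<in> B \<and> w \<in> B \<and> connected_on G B"
      proof -
        \<comment> \<open>Everything left after the removal of \<open>comp u\<close> hangs on
          \<open>v\<close>: the outside of \<open>A\<close> by the cut edge, and every other
          component by its neighbour of \<open>v\<close>.\<close>
        consider "w = v" | "w \<in> S - A" | "w \<in> A - {v}" using w by blast
        then show ?thesis
        proof cases
          case 1
          then show ?thesis using w connected_on_singleton by (intro exI[of _ "{v}"]) auto
        next
          case 2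
          then obtain z where "z \<in> S - A" "{v, z} \<in> snd G" using vz by blast
          then have "connected_on G ({v} \<union> (S - A))"
            by (intro connected_on_Un[OF connected_on_singleton cSA]) auto
          then show ?thesis using 2 cu v AS by (intro exI[of _ "{v} \<union> (S - A)"]) auto
        next
          case 3
          then obtain u' where u': "u' \<in> N" "w \<in> comp u'" using cover by blast
          then have u'A: "u' \<in> A - {v}" and "{v, u'} \<in> snd G" by (auto simp: N_def)
          then have con: "connected_on G ({v} \<union> comp u')"
            using comp_self by (intro connected_on_Un[OF connected_on_singleton comp_conn]) auto
          have "comp u' \<inter> comp u = {}"
          proof (rule ccontr)
            assume "comp u' \<inter> comp u \<noteq> {}"
            then obtain y where y: "walk G (A - {v}) u' y" "walk G (A - {v}) u y"
              by (auto simp: comp_def)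
            have "walk G (A - {v}) u' w" using u' by (simp add: comp_def)
            then have "walk G (A - {v}) u w"
              by (rule rtranclp_trans[OF y(2) rtranclp_trans[OF walk_sym[OF y(1)]]])
            then show False using w by (simp add: comp_def)
          qed
          then show ?thesis
            using con u' comp_sub[OF u'A] cu v AS by (intro exI[of _ "{v} \<union> comp u'"]) auto
        qed
      qed
    qed
    then have "Q (comp u)" using big cu AS comp_conn[OF uA] by (auto simp: Q_def)
    from min[OF this] have "card A \<le> card (comp u)" .
    also have "\<dots> < card A" using cu v finA by (intro psubset_card_mono) auto
    finally show False by simp
  qed
  have fv: "finite {u. {v, u} \<in> snd G}" "card {u. {v, u} \<in> snd G} \<le> \<Delta>"
    using deg v AS by auto
  have "N \<subseteq> {u. {v, u} \<in> snd G}" by (auto simp: N_def)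
  then have N: "finite N" "card N \<le> \<Delta>"
    by (auto intro: finite_subset[OF _ fv(1)] order_trans[OF card_mono[OF fv(1)] fv(2)])
  have "A \<subseteq> insert v (\<Union>u\<in>N. comp u)"
    using cover by blast
  moreover have "finite (insert v (\<Union>u\<in>N. comp u))"
    using finA comp_sub N unfolding N_def by (intro finite.insertI finite_UN_I) (auto intro: finite_subset)
  ultimately have "card A \<le> card (insert v (\<Union>u\<in>N. comp u))"
    by (rule card_mono[rotated])
  also have "\<dots> \<le> Suc (card (\<Union>u\<in>N. comp u))"
    by (rule card_insert_le_m1) simp_all
  also have "card (\<Union>u\<in>N. comp u) \<le> (\<Sum>u\<in>N. card (comp u))"
    using N by (intro card_UN_le)
  also have "\<dots> \<le> card N * (s - 1)"
    using sum_bounded_above[of N "\<lambda>u. card (comp u)" "s - 1"] small by simp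
  also have "\<dots> \<le> \<Delta> * (s - 1)" using N by simp
  finally show ?thesis using AS cA cSA sA by auto
qed

text \<open>Parts are split off one at a time by \<open>ex_small_part\<close>. The rest stays
  connected and the degree bound is inherited, so this continues until fewer than \<open>s\<close>
  vertices remain; these are the uncovered ones.\<close>

lemma ex_small_parts:
  fixes s \<Delta> :: nat
  assumes "finite S" "connected_on G S" "1 \<le> s"
    and "\<And>v. v \<in> S \<Longrightarrow> finite {u. {v, u} \<in> snd G} \<and> card {u. {v, u} \<in> snd G} \<le> \<Delta>"
  shows "\<exists>F. finite F \<and> disjoint F \<and> card S < card (\<Union>F) + s \<and>
    (\<forall>A\<in>F. A \<subseteq> S \<and> connected_on G A \<and> s \<le> card A \<and> card A \<le> 1 + \<Delta> * (s - 1))"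
  using assms
proof (induction "card S" arbitrary: S rule: less_induct)
  case less
  show ?case
  proof (cases "s \<le> card S")
    case False
    then show ?thesis by (intro exI[of _ "{}"]) auto
  next
    case True
    from ex_small_part[OF less.prems(1,2) this less.prems(3,4)]
    obtain A where A: "A \<subseteq> S" "connected_on G A" "connected_on G (S - A)" "s \<le> card A"
      "card A \<le> 1 + \<Delta> * (s - 1)" by blast
    have finA: "finite A" using A(1) less.prems(1) finite_subset by blast
    have c: "card (S - A) = card S - card A" "card A \<le> card S"
      using A(1) less.prems(1) finA by (auto intro: card_Diff_subset card_mono)
    have "card (S - A) < card S" using c A(4) less.prems(3) by linarith
    from less.hyps[OF this] obtain F where F: "finite F" "disjoint F"
      "card (S - A) < card (\<Union>F) + s"
      "\<And>B. B \<in> F \<Longrightarrow> B \<subseteq> S - A \<and> connected_on G B \<and> s \<le> card B \<and> card B \<le> 1 + \<Delta> * (s - 1)"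
      using less.prems A(3) by auto
    have dis: "A \<inter> \<Union>F = {}" using F(4) by blast
    have "finite (\<Union>F)" using F(4) less.prems(1) by (meson Union_least finite_Diff finite_subset)
    then have "card (\<Union>(insert A F)) = card A + card (\<Union>F)"
      using finA dis by (simp add: card_Un_disjoint)
    then have "card S < card (\<Union>(insert A F)) + s" using F(3) c by linarith
    moreover have "disjoint (insert A F)"
      using F(2) dis by (auto simp: pairwise_insert disjnt_def)
    ultimately show ?thesis
      using F A by (intro exI[of _ "insert A F"]) auto
  qed
qed

section \<open>Long weighted paths and their segments\<close>

text \<open>Depth-first search: \<open>X\<close> is the set of finished elements, \<open>P\<close> the stack with its top at the
  head, \<open>Y\<close> the set of unvisited elements. An element moves to \<open>X\<close> only when it has no neighbour in
  \<open>Y\<close>, and as soon as \<open>X\<close> has weight \<open>a\<close> the set \<open>Y\<close> is light, so that the stack is heavy.\<close>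

lemma dfs_path:
  fixes w :: "'a \<Rightarrow> real"
  assumes fin: "finite I" and w: "\<And>x. x \<in> I \<Longrightarrow> 0 \<le> w x \<and> w x \<le> b" and a: "0 < a" "0 \<le> b"
    and E: "\<And>X Y. \<lbrakk>X \<subseteq> I; Y \<subseteq> I; X \<inter> Y = {}; a \<le> sum w X; a \<le> sum w Y\<rbrakk>
          \<Longrightarrow> \<exists>x\<in>X. \<exists>y\<in>Y. E x y"
    and st: "X \<union> set P \<union> Y = I" "X \<inter> set P = {}" "X \<inter> Y = {}" "set P \<inter> Y = {}" "distinct P"
      "successively (\<lambda>y x. E x y) P" "\<And>x y. x \<in> X \<Longrightarrow> y \<in> Y \<Longrightarrow> \<not> E x y" "sum w X < a"
  shows "\<exists>P. distinct P \<and> set P \<subseteq> I \<and> successively (\<lambda>y x. E x y) P \<and>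
           sum w I - 2 * a - b \<le> sum w (set P)"
  using st
\<comment> \<open>A push moves an element from \<open>Y\<close> to the stack and changes the measure
  by -2 + 1; a pop changes it by -1.\<close>
proof (induction "2 * card Y + length P" arbitrary: X P Y rule: less_induct)
  case less
  have finX: "finite X" "finite Y" using less.prems(1) fin by (auto intro: finite_subset)
  have tot: "sum w I = sum w X + sum w (set P) + sum w Y"
  proof -
    have "sum w I = sum w (X \<union> set P) + sum w Y"
      unfolding less.prems(1)[symmetric]
      using finX less.prems by (intro sum.union_disjoint) auto
    also have "sum w (X \<union> set P) = sum w X + sum w (set P)"
      using finX less.prems by (intro sum.union_disjoint) auto
    finally show ?thesis .
  qed
  show ?case
  proof (cases "Y = {}")
    case True
    then show ?thesis using less.prems tot a by (intro exI[of _ P]) auto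
  next
    case False
    then have cY: "card Y > 0" using finX by auto
    show ?thesis
    proof (cases P)
      case Nil
      obtain y where y: "y \<in> Y" using False by blast
      show ?thesis
      proof (rule less.hyps[of "Y - {y}" "[y]" X])
        show "2 * card (Y - {y}) + length [y] < 2 * card Y + length P"
          using y finX cY Nil by (simp add: card_Diff_singleton)
      qed (use less.prems Nil y in auto)
    next
      case (Cons x P')
      show ?thesis
      proof (cases "\<exists>y\<in>Y. E x y")
        case True
        then obtain y where y: "y \<in> Y" "E x y" by blast
        show ?thesis
        proof (rule less.hyps[of "Y - {y}" "y # P" X])
          show "2 * card (Y - {y}) + length (y # P) < 2 * card Y + length P"
            using y finX cY by (simp add: card_Diff_singleton)
        qed (use less.prems Cons y in auto)
      next
        case False
        have xI: "x \<in> I" and xX: "x \<notin> X" using less.prems Cons by auto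
        show ?thesis
        \<comment> \<open>The top \<open>x\<close> has no neighbour left in \<open>Y\<close>. It is
          popped if \<open>X\<close> stays lighter than \<open>a\<close>. Otherwise
          \<open>insert x X\<close> is heavy without an edge to \<open>Y\<close>, so
          \<open>Y\<close> is light and the current stack, with \<open>x\<close> still on it, is the
          required path.\<close>
        proof (cases "sum w (insert x X) < a")
          case True
          show ?thesis
          proof (rule less.hyps[of Y P' "insert x X"])
            show "2 * card Y + length P' < 2 * card Y + length P" using Cons by simp
          qed (use less.prems Cons False True in \<open>auto simp: successively_Cons\<close>)
        next
          case ge: False
          have ne: "\<not> (\<exists>x'\<in>insert x X. \<exists>y\<in>Y. E x' y)" using False less.prems by blast
          have "sum w Y < a"
          proof (rule ccontr)
            assume "\<not> sum w Y < a"
            then have "\<exists>x'\<in>insert x X. \<exists>y\<in>Y. E x' y"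
              using ge less.prems Cons by (intro E) auto
            then show False using ne by blast
          qed
          moreover have "sum w X < a" by (rule less.prems)
          ultimately show ?thesis using less.prems tot a by (intro exI[of _ P]) auto
        qed
      qed
    qed
  qed
qed

lemma ex_heavy_path:
  fixes w :: "'a \<Rightarrow> real"
  assumes "finite I" "\<And>x. x \<in> I \<Longrightarrow> 0 \<le> w x \<and> w x \<le> b" "0 < a" "0 \<le> b"
    and "\<And>X Y. \<lbrakk>X \<subseteq> I; Y \<subseteq> I; X \<inter> Y = {}; a \<le> sum w X; a \<le> sum w Y\<rbrakk>
          \<Longrightarrow> \<exists>x\<in>X. \<exists>y\<in>Y. E x y"
  shows "\<exists>P. distinct P \<and> set P \<subseteq> I \<and> successively (\<lambda>y x. E x y) P \<and>
           sum w I - 2 * a - b \<le> sum w (set P)"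
  by (rule dfs_path[where X = "{}" and P = "[]" and Y = I, OF assms]) (use assms in auto)

text \<open>The prefix ends as soon as its weight reaches \<open>K\<close>; the last element
  overshoots by at most \<open>b\<close>.\<close>

lemma ex_prefix_weight:
  fixes w :: "'a \<Rightarrow> real"
  assumes "\<And>x. x \<in> set P \<Longrightarrow> w x \<le> b" "0 \<le> K" "0 \<le> b" "K \<le> sum_list (map w P)"
  shows "\<exists>xs ys. P = xs @ ys \<and> K \<le> sum_list (map w xs) \<and> sum_list (map w xs) \<le> K + b"
  using assms
proof (induction P arbitrary: K)
  case Nil
  then show ?case by auto
next
  case (Cons x P)
  show ?case
  proof (cases "K \<le> w x")
    case True
    show ?thesis
      using True Cons.prems(1)[of x] Cons.prems(2)
      by (intro exI[of _ "[x]"] exI[of _ P]) auto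
  next
    case False
    then have "\<exists>xs ys. P = xs @ ys \<and> K - w x \<le> sum_list (map w xs) \<and>
        sum_list (map w xs) \<le> K - w x + b"
      using Cons.prems by (intro Cons.IH) auto
    then obtain xs ys where "P = xs @ ys" "K - w x \<le> sum_list (map w xs)"
      "sum_list (map w xs) \<le> K - w x + b" by blast
    then show ?thesis
      by (intro exI[of _ "x # xs"] exI[of _ ys]) auto
  qed
qed

text \<open>Prefixes of weight at least \<open>K\<close> are cut off one after another. Each uses up
  at most \<open>K + b\<close> of the total weight, so \<open>t\<close> of them fit.\<close>

lemma ex_segments:
  fixes w :: "'a \<Rightarrow> real"
  assumes "\<And>x. x \<in> set P \<Longrightarrow> w x \<le> b" "0 \<le> K" "0 \<le> b" "distinct P" "successively E P"
    and "real t * (K + b) \<le> sum_list (map w P)"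
  shows "\<exists>\<psi> :: nat \<Rightarrow> 'a list.
           (\<forall>i<t. distinct (\<psi> i) \<and> successively E (\<psi> i) \<and> set (\<psi> i) \<subseteq> set P \<and>
             K \<le> sum_list (map w (\<psi> i))) \<and>
           (\<forall>i<t. \<forall>j<t. i \<noteq> j \<longrightarrow> set (\<psi> i) \<inter> set (\<psi> j) = {})"
  using assms
proof (induction t arbitrary: P)
  case 0
  then show ?case by simp
next
  case (Suc t)
  have *: "real (Suc t) * (K + b) = K + b + real t * (K + b)" by (simp add: algebra_simps)
  have "0 \<le> real t * (K + b)" using Suc.prems by simp
  then have "K \<le> sum_list (map w P)" using Suc.prems(3,6) * by linarith
  then obtain xs ys where xs: "P = xs @ ys" "K \<le> sum_list (map w xs)" "sum_list (map w xs) \<le> K + b"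
    using ex_prefix_weight[of P w b K] Suc.prems by blast
  have "real t * (K + b) \<le> sum_list (map w ys)" using xs Suc.prems(6) * by auto
  moreover have "\<And>x. x \<in> set ys \<Longrightarrow> w x \<le> b" "distinct ys" "successively E ys"
    using Suc.prems xs(1) by (simp_all add: successively_append_iff)
  ultimately have "\<exists>\<psi> :: nat \<Rightarrow> 'a list.
           (\<forall>i<t. distinct (\<psi> i) \<and> successively E (\<psi> i) \<and> set (\<psi> i) \<subseteq> set ys \<and>
             K \<le> sum_list (map w (\<psi> i))) \<and>
           (\<forall>i<t. \<forall>j<t. i \<noteq> j \<longrightarrow> set (\<psi> i) \<inter> set (\<psi> j) = {})"
    using Suc.prems(2,3) by (intro Suc.IH)
  then obtain \<psi> :: "nat \<Rightarrow> 'a list" where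
    \<psi>1: "\<forall>i<t. distinct (\<psi> i) \<and> successively E (\<psi> i) \<and> set (\<psi> i) \<subseteq> set ys \<and>
       K \<le> sum_list (map w (\<psi> i))" and
    \<psi>2: "\<forall>i<t. \<forall>j<t. i \<noteq> j \<longrightarrow> set (\<psi> i) \<inter> set (\<psi> j) = {}"
    by (elim exE conjE)
  have dis: "set xs \<inter> set ys = {}" and sx: "distinct xs" "successively E xs"
    using Suc.prems xs(1) by (auto simp: successively_append_iff)
  have sub: "k < t \<Longrightarrow> set (\<psi> k) \<subseteq> set ys" for k using \<psi>1 by blast
  have 1: "distinct ((\<psi>(t := xs)) i) \<and> successively E ((\<psi>(t := xs)) i) \<and>
      set ((\<psi>(t := xs)) i) \<subseteq> set P \<and> K \<le> sum_list (map w ((\<psi>(t := xs)) i))" if "i < Suc t" for i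
  proof (cases "i = t")
    case True
    then show ?thesis using xs sx by auto
  next
    case False
    then have "i < t" using that by simp
    moreover from sub[OF this] have "set (\<psi> i) \<subseteq> set P" using xs(1) by auto
    ultimately show ?thesis using \<psi>1 by simp
  qed
  have 2: "set ((\<psi>(t := xs)) i) \<inter> set ((\<psi>(t := xs)) j) = {}"
    if "i < Suc t" "j < Suc t" "i \<noteq> j" for i j
    using that dis sub[of i] sub[of j] \<psi>2 by (cases "i = t"; cases "j = t") auto
  show ?case
    by (rule exI[of _ "\<psi>(t := xs)"], rule conjI; intro allI impI) (rule 1 2; assumption)+
qed

section \<open>From paths of parts to disjoint connected blocks\<close>

lemma connected_on_Union_path:
  assumes "\<And>A. A \<in> set P \<Longrightarrow> connected_on G A"
    and "successively (\<lambda>B A. \<exists>x\<in>A. \<exists>y\<in>B. {x, y} \<in> snd G) P"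
  shows "connected_on G (\<Union>(set P))"
  using assms
proof (induction P)
  case Nil
  then show ?case by (simp add: connected_on_empty)
next
  case (Cons A P)
  show ?case
  proof (cases P)
    case Nil
    then show ?thesis using Cons.prems by simp
  next
    case (Cons B Q)
    with Cons.prems obtain x y where "x \<in> B" "y \<in> A" "{y, x} \<in> snd G"
      by (auto simp: insert_commute)
    moreover have "connected_on G (\<Union>(set P))"
      using Cons.prems Cons.IH by (auto simp: successively_Cons)
    ultimately show ?thesis
      using connected_on_Un[of G A "\<Union>(set P)" y x] Cons.prems Cons by auto
  qed
qed

lemma disjoint_Union_Int:
  assumes "disjoint F" "X \<subseteq> F" "Y \<subseteq> F" "X \<inter> Y = {}"
  shows "\<Union>X \<inter> \<Union>Y = {}"
proof (rule ccontr)
  assume "\<Union>X \<inter> \<Union>Y \<noteq> {}"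
  then obtain A B where AB: "A \<in> X" "B \<in> Y" "A \<inter> B \<noteq> {}" by blast
  then have "A \<noteq> B" "A \<in> F" "B \<in> F" using assms by auto
  then show False using disjointD[OF assms(1)] AB(3) by blast
qed

text \<open>Depth-first search runs on the parts, weighted by cardinality, two parts being adjacent
  when an edge of \<open>G\<close> joins them. The loss \<open>2 * a + b\<close> is that of
  \<open>ex_heavy_path\<close>. Each segment of the path found has a connected union, which serves
  as a block.\<close>

lemma ex_connected_blocks:
  fixes F :: "nat set set" and a b K :: real and t :: nat
  assumes F: "finite F" "disjoint F"
    and parts: "\<And>A. A \<in> F \<Longrightarrow> finite A \<and> connected_on G A \<and> real (card A) \<le> b"
    and pos: "0 < a" "0 \<le> b" "0 \<le> K"
    and joined: "\<And>X Y. \<lbrakk>X \<subseteq> F; Y \<subseteq> F; X \<inter> Y = {}; a \<le> card (\<Union>X); a \<le> card (\<Union>Y)\<rbrakk>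
          \<Longrightarrow> \<exists>x\<in>\<Union>X. \<exists>y\<in>\<Union>Y. {x, y} \<in> snd G"
    and t: "real t * (K + b) \<le> card (\<Union>F) - 2 * a - b"
  shows "\<exists>B :: nat \<Rightarrow> nat set. (\<forall>i<t. B i \<subseteq> \<Union>F \<and> connected_on G (B i) \<and> K \<le> card (B i)) \<and>
    (\<forall>i<t. \<forall>j<t. i \<noteq> j \<longrightarrow> B i \<inter> B j = {})"
proof -
  define E where "E A B \<longleftrightarrow> (\<exists>x\<in>A. \<exists>y\<in>B. {x, y} \<in> snd G)" for A B
  define w where "w A = real (card A)" for A :: "nat set"
  have wU: "real (card (\<Union>X)) = sum w X" if "X \<subseteq> F" for X
  proof -
    have "card (\<Union>X) = sum card X"
      using that F parts by (intro card_Union_disjoint) (auto simp: pairwise_def disjnt_def subset_eq disjoint_def)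
    then show ?thesis by (simp add: w_def)
  qed
  have "\<exists>P. distinct P \<and> set P \<subseteq> F \<and> successively (\<lambda>B A. E A B) P \<and>
      sum w F - 2 * a - b \<le> sum w (set P)"
  proof (rule ex_heavy_path)
    fix X Y assume XY: "X \<subseteq> F" "Y \<subseteq> F" "X \<inter> Y = {}" "a \<le> sum w X" "a \<le> sum w Y"
    then have "\<exists>x\<in>\<Union>X. \<exists>y\<in>\<Union>Y. {x, y} \<in> snd G" by (intro joined) (auto simp: wU)
    then show "\<exists>A\<in>X. \<exists>B\<in>Y. E A B" by (auto simp: E_def)
  qed (use F parts pos in \<open>auto simp: w_def\<close>)
  then obtain P where P: "distinct P" "set P \<subseteq> F" "successively (\<lambda>B A. E A B) P"
    "sum w F - 2 * a - b \<le> sum w (set P)" by blast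
  have "real t * (K + b) \<le> sum_list (map w P)"
    using t P wU[OF order_refl] by (simp add: sum_list_distinct_conv_sum_set)
  then have "\<exists>\<psi> :: nat \<Rightarrow> nat set list.
           (\<forall>i<t. distinct (\<psi> i) \<and> successively (\<lambda>B A. E A B) (\<psi> i) \<and> set (\<psi> i) \<subseteq> set P \<and>
             K \<le> sum_list (map w (\<psi> i))) \<and>
           (\<forall>i<t. \<forall>j<t. i \<noteq> j \<longrightarrow> set (\<psi> i) \<inter> set (\<psi> j) = {})"
    using P parts pos by (intro ex_segments) (auto simp: w_def)
  then obtain \<psi> :: "nat \<Rightarrow> nat set list" where
    \<psi>: "\<forall>i<t. distinct (\<psi> i) \<and> successively (\<lambda>B A. E A B) (\<psi> i) \<and> set (\<psi> i) \<subseteq> set P \<and>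
       K \<le> sum_list (map w (\<psi> i))" and
    dis: "\<forall>i<t. \<forall>j<t. i \<noteq> j \<longrightarrow> set (\<psi> i) \<inter> set (\<psi> j) = {}"
    by (elim exE conjE)
  show ?thesis
  proof (rule exI[of _ "\<lambda>i. \<Union>(set (\<psi> i))"], intro conjI allI impI)
    fix i assume i: "i < t"
    have sub: "set (\<psi> i) \<subseteq> F" using \<psi> i P(2) by blast
    then show "\<Union>(set (\<psi> i)) \<subseteq> \<Union>F" by blast
    show "connected_on G (\<Union>(set (\<psi> i)))"
      using \<psi> i sub parts by (intro connected_on_Union_path) (auto simp: E_def)
    show "K \<le> real (card (\<Union>(set (\<psi> i))))"
      using \<psi> i wU[OF sub] sum_list_distinct_conv_sum_set[of "\<psi> i" w] by metis
  next
    fix i j assume ij: "i < t" "j < t" "i \<noteq> j"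
    then have "set (\<psi> i) \<subseteq> F" "set (\<psi> j) \<subseteq> F" "set (\<psi> i) \<inter> set (\<psi> j) = {}"
      using \<psi> P(2) dis by blast+
    then show "\<Union>(set (\<psi> i)) \<inter> \<Union>(set (\<psi> j)) = {}"
      by (rule disjoint_Union_Int[OF F(2)])
  qed
qed

section \<open>Products of Bernoulli variables\<close>

lemma measure_bind_pmf:
  "measure_pmf.prob (bind_pmf M N) S = (\<integral>x. measure_pmf.prob (N x) S \<partial>measure_pmf M)"
proof -
  have "measure_pmf.prob Q S = pmf (map_pmf (\<lambda>x. x \<in> S) Q) True" for Q
    by (simp add: pmf_map vimage_def)
  then show ?thesis by (simp add: map_bind_pmf pmf_bind)
qed

text \<open>First-stage outcomes outside \<open>A\<close> are discarded, the others contribute at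
  least \<open>\<beta>\<close> each. Here \<open>A\<close> will be the event that the first round of
  edges succeeds.\<close>

lemma measure_bind_pmf_ge:
  assumes "\<And>x. x \<in> A \<Longrightarrow> \<beta> \<le> measure_pmf.prob (N x) S"
  shows "measure_pmf.prob M A * \<beta> \<le> measure_pmf.prob (bind_pmf M N) S"
proof -
  have "measure_pmf.prob M A * \<beta> = (\<integral>x. indicator A x * \<beta> \<partial>measure_pmf M)"
    by simp
  also have "\<dots> \<le> (\<integral>x. measure_pmf.prob (N x) S \<partial>measure_pmf M)"
    using assms
    by (intro integral_mono measure_pmf.integrable_const_bound[where B = 1]
        integrable_mult_left measure_pmf.integrable_const_bound[where B = 1])
      (auto simp: indicator_def)
  finally show ?thesis by (simp add: measure_bind_pmf)
qed

lemma prob_Pi_bernoulli_none: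
  assumes A: "finite A" "D \<subseteq> A" and p: "0 \<le> p" "p \<le> 1"
  shows "measure_pmf.prob (Pi_pmf A False (\<lambda>_. bernoulli_pmf p)) {b. \<forall>e\<in>D. \<not> b e} = (1 - p) ^ card D"
proof -
  have fD: "finite D" using A finite_subset by blast
  have "{b. \<forall>e\<in>D. \<not> b e} = Pi A (\<lambda>e. if e \<in> D then {False} else UNIV)"
    using A by (auto simp: Pi_def split: if_splits)
  then have "measure_pmf.prob (Pi_pmf A False (\<lambda>_. bernoulli_pmf p)) {b. \<forall>e\<in>D. \<not> b e} =
      (\<Prod>e\<in>A. measure_pmf.prob (bernoulli_pmf p) (if e \<in> D then {False} else UNIV))"
    using A by (simp add: measure_Pi_pmf_Pi)
  also have "\<dots> = (\<Prod>e\<in>A. if e \<in> D then 1 - p else 1)"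
    using p by (intro prod.cong) (auto simp: measure_pmf_single)
  also have "\<dots> = (1 - p) ^ card D"
    using A fD by (simp add: prod.If_cases Int_absorb1)
  finally show ?thesis .
qed

lemma map_Pi_bernoulli_Ex:
  assumes A: "finite D" and p: "0 \<le> p" "p \<le> 1"
  shows "map_pmf (\<lambda>b. \<exists>a\<in>D. b a) (Pi_pmf D False (\<lambda>_. bernoulli_pmf p)) =
    bernoulli_pmf (1 - (1 - p) ^ card D)"
proof -
  let ?P = "map_pmf (\<lambda>b. \<exists>a\<in>D. b a) (Pi_pmf D False (\<lambda>_. bernoulli_pmf p))"
  have le: "(1 - p) ^ card D \<le> 1" "0 \<le> (1 - p) ^ card D" using p by (auto intro: power_le_one)
  have F: "pmf ?P False = (1 - p) ^ card D"
    using prob_Pi_bernoulli_none[OF A order_refl p] by (simp add: pmf_map vimage_def)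
  have "pmf Q True + pmf Q False = 1" for Q :: "bool pmf"
    using sum_pmf_eq_1[OF finite subset_UNIV, of Q] by (simp add: UNIV_bool add.commute)
  from this[of ?P] have "pmf ?P True + pmf ?P False = 1" .
  then have T: "pmf ?P True = 1 - (1 - p) ^ card D" using F by simp
  show ?thesis
  proof (rule pmf_eqI)
    fix x show "pmf ?P x = pmf (bernoulli_pmf (1 - (1 - p) ^ card D)) x"
      using F T le by (cases x) simp_all
  qed
qed

text \<open>An element is missed by two independent rounds with probability
  \<open>(1 - q)\<^sup>2\<close>, so the union of the rounds has density \<open>p\<close>. The
  conjunct \<open>e \<in> A\<close> reproduces the default value \<open>False\<close> outside
  \<open>A\<close>.\<close>

lemma Pi_bernoulli_sprinkle:
  assumes A: "finite A" and q: "0 \<le> q" "q \<le> 1" and p: "1 - p = (1 - q)\<^sup>2"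
  shows "Pi_pmf A False (\<lambda>_. bernoulli_pmf p) =
    bind_pmf (Pi_pmf A False (\<lambda>_. bernoulli_pmf q))
      (\<lambda>b. map_pmf (\<lambda>b' e. e \<in> A \<and> (b e \<or> b' e)) (Pi_pmf A False (\<lambda>_. bernoulli_pmf q)))"
proof -
  have "(1 - q)\<^sup>2 \<le> 1" using q by (intro power_le_one) auto
  then have p01: "0 \<le> p" "p \<le> 1" using p zero_le_power2[of "1 - q"] by linarith+
  have one: "bernoulli_pmf p =
      bind_pmf (bernoulli_pmf q) (\<lambda>x. bind_pmf (bernoulli_pmf q) (\<lambda>y. return_pmf (x \<or> y)))"
    (is "_ = ?R")
  proof (rule pmf_eqI)
    fix x
    have "p = q + (1 - q) * q" using p by (simp add: power2_eq_square algebra_simps)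
    then show "pmf (bernoulli_pmf p) x = pmf ?R x"
      using p01 q by (cases x) (simp_all add: pmf_bind algebra_simps)
  qed
  have conj: "((x \<in> A \<longrightarrow> P) \<and> x \<in> A) \<longleftrightarrow> x \<in> A \<and> P" for x P by blast
  show ?thesis
    unfolding one
    by (subst Pi_pmf_bind[OF A, where d' = False], subst Pi_pmf_bind[OF A, where d' = False])
      (simp add: A map_pmf_def conj)
qed

text \<open>Stochastic domination. The events that \<open>D e\<close> is hit are independent, as the
  sets \<open>D e\<close> are disjoint, and each has probability
  \<open>1 - (1 - p) ^ card (D e)\<close>, which is at least \<open>q\<close>. Replacing the
  coordinates one by one can only raise the probability of an increasing event
  \<open>U\<close>.\<close>

lemma prob_Pi_bernoulli_blocks:
  fixes E :: "'e set" and D :: "'e \<Rightarrow> 'a set" and U :: "('e \<Rightarrow> bool) \<Rightarrow> bool"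
  assumes "finite E" and p: "0 \<le> p" "p \<le> 1" and q: "0 \<le> q" "q \<le> 1"
    and "\<And>e. e \<in> E \<Longrightarrow> finite (D e) \<and> (1 - p) ^ card (D e) \<le> 1 - q"
    and "\<And>e e'. e \<in> E \<Longrightarrow> e' \<in> E \<Longrightarrow> e \<noteq> e' \<Longrightarrow> D e \<inter> D e' = {}"
    and "\<And>b b'. (\<And>e. b e \<Longrightarrow> b' e) \<Longrightarrow> U b \<Longrightarrow> U b'"
  shows "measure_pmf.prob (Pi_pmf E False (\<lambda>_. bernoulli_pmf q)) {b. U b} \<le>
    measure_pmf.prob (Pi_pmf (\<Union>e\<in>E. D e) False (\<lambda>_. bernoulli_pmf p))
      {b. U (\<lambda>e. e \<in> E \<and> (\<exists>a\<in>D e. b a))}"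
  using assms(1,6-8)
proof (induction E arbitrary: U rule: finite_induct)
  case empty
  then show ?case by simp
next
  case (insert e E)
  define \<phi> where "\<phi> b = (\<lambda>e. e \<in> E \<and> (\<exists>a\<in>D e. b a))" for b
  define W where "W = (\<Union>e\<in>E. D e)"
  \<comment> \<open>\<open>l x\<close> and \<open>h x\<close> are the two probabilities conditioned
    on coordinate \<open>e\<close> having value \<open>x\<close>. Fixing it turns \<open>U\<close>
    into another increasing event, which is why the induction leaves \<open>U\<close>
    arbitrary.\<close>
  define l where "l x = measure_pmf.prob (Pi_pmf E False (\<lambda>_. bernoulli_pmf q)) {b. U (b(e := x))}" for x
  define h where "h x = measure_pmf.prob (Pi_pmf W False (\<lambda>_. bernoulli_pmf p)) {b. U ((\<phi> b)(e := x))}" for x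
  define qe where "qe = 1 - (1 - p) ^ card (D e)"
  have fin: "finite (D e)" "finite W" using insert by (auto simp: W_def)
  have disj: "D e \<inter> W = {}" using insert.prems(2)[of e] insert.hyps by (fastforce simp: W_def)
  have qe: "q \<le> qe" "qe \<le> 1" using insert.prems(1)[of e] p by (auto simp: qe_def)
  have lh: "l x \<le> h x" for x
    unfolding l_def h_def \<phi>_def W_def
  proof (rule insert.IH)
    fix b b' :: "'e \<Rightarrow> bool"
    assume b: "\<And>e. b e \<Longrightarrow> b' e" "U (b(e := x))"
    show "U (b'(e := x))"
      by (rule insert.prems(3)[OF _ b(2)]) (use b(1) in \<open>auto split: if_splits\<close>)
  qed (use insert.prems in auto)
  have hTF: "h False \<le> h True"
    unfolding h_def
  proof (intro measure_pmf.finite_measure_mono)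
    show "{b. U ((\<phi> b)(e := False))} \<subseteq> {b. U ((\<phi> b)(e := True))}"
      by (auto elim!: insert.prems(3)[rotated] split: if_splits)
  qed simp
  have "measure_pmf.prob (Pi_pmf (insert e E) False (\<lambda>_. bernoulli_pmf q)) {b. U b} =
      (\<integral>x. l x \<partial>bernoulli_pmf q)"
    unfolding l_def using insert.hyps
    by (simp add: Pi_pmf_insert' measure_bind_pmf map_pmf_def[symmetric] vimage_def)
  also have "\<dots> = l True * q + l False * (1 - q)" using q by simp
  also have "\<dots> \<le> h True * q + h False * (1 - q)"
    using q by (intro add_mono mult_right_mono lh) auto
  \<comment> \<open>By \<open>hTF\<close>, moving weight from \<open>False\<close> to
    \<open>True\<close> increases the mixture.\<close>
  also have "\<dots> \<le> h True * qe + h False * (1 - qe)"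
    using mult_nonneg_nonneg[of "h True - h False" "qe - q"] hTF qe by (simp add: algebra_simps)
  also have "\<dots> = (\<integral>x. h x \<partial>bernoulli_pmf qe)" using qe q by simp
  also have "\<dots> = (\<integral>f. h (\<exists>a\<in>D e. f a) \<partial>Pi_pmf (D e) False (\<lambda>_. bernoulli_pmf p))"
    unfolding qe_def map_Pi_bernoulli_Ex[OF fin(1) p, symmetric] by simp
  also have "\<dots> = measure_pmf.prob (Pi_pmf (D e \<union> W) False (\<lambda>_. bernoulli_pmf p))
      {b. U (\<lambda>e'. e' \<in> insert e E \<and> (\<exists>a\<in>D e'. b a))}"
  proof -
    \<comment> \<open>Disjointness of \<open>D e\<close> and \<open>W\<close> lets the two families
      of bits decide coordinate \<open>e\<close> and the remaining coordinates separately.\<close>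
    have eq: "(\<lambda>e'. e' \<in> insert e E \<and> (\<exists>a\<in>D e'. if a \<in> D e then f a else g a)) =
        (\<phi> g)(e := \<exists>a\<in>D e. f a)" for f g
      using disj insert.hyps by (fastforce simp: fun_eq_iff \<phi>_def W_def)
    show ?thesis
      using eq unfolding Pi_pmf_union[OF fin disj] pair_pmf_def map_bind_pmf h_def
      by (simp add: measure_bind_pmf map_pmf_def[symmetric] vimage_def)
  qed
  also have "D e \<union> W = (\<Union>e\<in>insert e E. D e)" by (simp add: W_def)
  finally show ?case .
qed

section \<open>Random edges between disjoint sets\<close>

definition cross_pairs :: "nat set \<Rightarrow> nat set \<Rightarrow> nat set set" where
  "cross_pairs U V = (\<lambda>(x, y). {x, y}) ` (U \<times> V)"

lemma cross_pairs_iff: "d \<in> cross_pairs U V \<longleftrightarrow> (\<exists>x\<in>U. \<exists>y\<in>V. d = {x, y})"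
  by (auto simp: cross_pairs_def)

lemma finite_cross_pairs: "finite U \<Longrightarrow> finite V \<Longrightarrow> finite (cross_pairs U V)"
  by (simp add: cross_pairs_def)

lemma card_cross_pairs:
  assumes "U \<inter> V = {}"
  shows "card (cross_pairs U V) = card U * card V"
proof -
  have "inj_on (\<lambda>(x, y). {x, y}) (U \<times> V)"
    using assms by (auto simp: inj_on_def doubleton_eq_iff)
  then show ?thesis by (simp add: cross_pairs_def card_image card_cartesian_product)
qed

lemma cross_pairs_subset:
  assumes "U \<subseteq> {..<n}" "V \<subseteq> {..<n}" "U \<inter> V = {}"
  shows "cross_pairs U V \<subseteq> pairs n"
  using assms by (fastforce simp: cross_pairs_iff pairs_def)

lemma finite_pairs: "finite (pairs n)"
proof -
  have "pairs n \<subseteq> Pow {..<n}" by (auto simp: pairs_def)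
  then show ?thesis by (rule finite_subset) simp
qed

lemma one_minus_power_le_exp:
  fixes p :: real
  assumes "0 \<le> p" "p \<le> 1"
  shows "(1 - p) ^ k \<le> exp (- p * k)"
proof -
  have "(1 - p) ^ k \<le> exp (- p) ^ k"
    using assms exp_ge_add_one_self[of "- p"] by (intro power_mono) auto
  then show ?thesis by (simp add: exp_of_nat2_mult[symmetric])
qed

text \<open>A union bound: there are at most \<open>4 ^ card F\<close> pairs of subfamilies, and for
  each admissible pair at least \<open>a\<^sup>2\<close> distinct vertex pairs would all have to be
  missing.\<close>

lemma prob_joined:
  fixes F :: "nat set set" and a p :: real
  assumes F: "finite F" "disjoint F" "\<And>A. A \<in> F \<Longrightarrow> A \<subseteq> {..<n}"
    and p: "0 \<le> p" "p \<le> 1" and a: "0 \<le> a"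
  shows "1 - 4 ^ card F * exp (- p * a\<^sup>2) \<le>
    measure_pmf.prob (Pi_pmf (pairs n) False (\<lambda>_. bernoulli_pmf p))
      {b. \<forall>X Y. X \<subseteq> F \<longrightarrow> Y \<subseteq> F \<longrightarrow> X \<inter> Y = {} \<longrightarrow> a \<le> card (\<Union>X) \<longrightarrow> a \<le> card (\<Union>Y) \<longrightarrow>
        (\<exists>x\<in>\<Union>X. \<exists>y\<in>\<Union>Y. b {x, y})}"
    (is "_ \<le> measure_pmf.prob ?M ?J")
proof -
  define Z where "Z = {(X, Y). X \<subseteq> F \<and> Y \<subseteq> F \<and> X \<inter> Y = {} \<and> a \<le> card (\<Union>X) \<and> a \<le> card (\<Union>Y)}"
  define N where "N = (\<lambda>(X, Y). {b :: nat set \<Rightarrow> bool. \<forall>e\<in>cross_pairs (\<Union>X) (\<Union>Y). \<not> b e})"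
  have Z: "Z \<subseteq> Pow F \<times> Pow F" by (auto simp: Z_def)
  then have finZ: "finite Z" using F(1) by (meson finite_Pow_iff finite_SigmaI finite_subset)
  have "card Z \<le> card (Pow F \<times> Pow F)" using Z F(1) by (intro card_mono) auto
  also have "\<dots> = 4 ^ card F"
    using F(1) by (simp add: card_cartesian_product card_Pow power_mult_distrib[symmetric])
  finally have cZ: "real (card Z) \<le> 4 ^ card F"
    by (metis of_nat_le_iff of_nat_numeral of_nat_power)
  have each: "measure_pmf.prob ?M (N XY) \<le> exp (- p * a\<^sup>2)" if XY: "XY \<in> Z" for XY
  proof -
    obtain X Y where [simp]: "XY = (X, Y)" by (cases XY)
    have sub: "\<Union>X \<subseteq> {..<n}" "\<Union>Y \<subseteq> {..<n}" using XY F(3) by (auto simp: Z_def)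
    have dis: "\<Union>X \<inter> \<Union>Y = {}"
      using XY by (intro disjoint_Union_Int[OF F(2)]) (auto simp: Z_def)
    have "measure_pmf.prob ?M (N XY) = (1 - p) ^ (card (\<Union>X) * card (\<Union>Y))"
      using prob_Pi_bernoulli_none[OF finite_pairs cross_pairs_subset[OF sub dis] p]
      by (simp add: N_def card_cross_pairs[OF dis])
    also have "\<dots> \<le> exp (- p * real (card (\<Union>X) * card (\<Union>Y)))"
      by (rule one_minus_power_le_exp[OF p])
    also have "\<dots> \<le> exp (- p * a\<^sup>2)"
    proof -
      have "a * a \<le> real (card (\<Union>X)) * real (card (\<Union>Y))"
        using XY a by (intro mult_mono) (auto simp: Z_def)
      then show ?thesis using p by (simp add: power2_eq_square mult_left_mono)
    qed
    finally show ?thesis .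
  qed
  have "- ?J \<subseteq> (\<Union>XY\<in>Z. N XY)"
  proof
    fix b assume "b \<in> - ?J"
    then obtain X Y where XY: "X \<subseteq> F" "Y \<subseteq> F" "X \<inter> Y = {}" "a \<le> card (\<Union>X)" "a \<le> card (\<Union>Y)"
      "\<not> (\<exists>x\<in>\<Union>X. \<exists>y\<in>\<Union>Y. b {x, y})"
      unfolding Compl_iff mem_Collect_eq by metis
    have "(X, Y) \<in> Z" using XY by (simp add: Z_def)
    moreover have "b \<in> N (X, Y)" using XY(6) by (auto simp: N_def cross_pairs_iff)
    ultimately show "b \<in> (\<Union>XY\<in>Z. N XY)" by blast
  qed
  then have "measure_pmf.prob ?M (- ?J) \<le> measure_pmf.prob ?M (\<Union>XY\<in>Z. N XY)"
    by (intro measure_pmf.finite_measure_mono) auto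
  also have "\<dots> \<le> (\<Sum>XY\<in>Z. measure_pmf.prob ?M (N XY))"
    using finZ by (intro measure_pmf.finite_measure_subadditive_finite) auto
  also have "\<dots> \<le> (\<Sum>XY\<in>Z. exp (- p * a\<^sup>2))" by (intro sum_mono each)
  also have "\<dots> \<le> 4 ^ card F * exp (- p * a\<^sup>2)"
    using cZ by (simp add: mult_right_mono)
  finally show ?thesis
    using measure_pmf.prob_compl[of ?J ?M] by (simp add: Compl_eq_Diff_UNIV)
qed

text \<open>Contracting the blocks of \<open>R\<close> together with the random edges gives a minor
  on \<open>t\<close> vertices in which \<open>i\<close> and \<open>j\<close> are adjacent once one
  of the \<open>card (B i) * card (B j)\<close> cross pairs appears. By \<open>pq\<close> this has
  probability at least \<open>q\<close>, independently over block pairs, and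
  \<open>x \<le> f G\<close> is an increasing event.\<close>

lemma prob_gnp_le_blocks:
  fixes B :: "nat \<Rightarrow> nat set"
  assumes f: "minor_monotone f" and R: "is_graph R" "fst R = {..<n}"
    and B: "\<And>i. i < t \<Longrightarrow> B i \<noteq> {} \<and> B i \<subseteq> {..<n} \<and> connected_on R (B i)"
    and disj: "\<And>i j. i < t \<Longrightarrow> j < t \<Longrightarrow> i \<noteq> j \<Longrightarrow> B i \<inter> B j = {}"
    and p: "0 \<le> p" "p \<le> 1" and q: "0 \<le> q" "q \<le> 1"
    and pq: "\<And>i j. i < t \<Longrightarrow> j < t \<Longrightarrow> i \<noteq> j \<Longrightarrow> (1 - p) ^ (card (B i) * card (B j)) \<le> 1 - q"
  shows "measure_pmf.prob (gnp t q) {G. x \<le> f G} \<le>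
    measure_pmf.prob (Pi_pmf (pairs n) False (\<lambda>_. bernoulli_pmf p))
      {b. x \<le> f (fst R, snd R \<union> {e \<in> pairs n. b e})}"
proof -
  define D where "D e = (\<Union>(i, j)\<in>{(i, j). e = {i, j} \<and> i \<noteq> j}. cross_pairs (B i) (B j))" for e
  define Gr where "Gr b = ({..<t}, {e \<in> pairs t. b e})" for b :: "nat set \<Rightarrow> bool"
  define U where "U b \<longleftrightarrow> x \<le> f (Gr b)" for b
  have graph_Gr: "is_graph (Gr b)" for b
    by (auto simp: is_graph_def Gr_def pairs_def)
  have D: "D {i, j} = cross_pairs (B i) (B j)" if "i \<noteq> j" for i j
    using that by (fastforce simp: D_def doubleton_eq_iff cross_pairs_iff insert_commute)
  have finB: "finite (B i)" if "i < t" for i using B[OF that] finite_subset by blast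
  have Dpairs: "(\<Union>e\<in>pairs t. D e) \<subseteq> pairs n"
  proof
    fix d assume "d \<in> (\<Union>e\<in>pairs t. D e)"
    then obtain i j where ij: "i < t" "j < t" "i \<noteq> j" "d \<in> D {i, j}" by (auto simp: pairs_def)
    then show "d \<in> pairs n"
      using cross_pairs_subset[of "B i" n "B j"] B disj D by blast
  qed
  have "measure_pmf.prob (gnp t q) {G. x \<le> f G} =
      measure_pmf.prob (Pi_pmf (pairs t) False (\<lambda>_. bernoulli_pmf q)) {b. U b}"
    by (simp add: gnp_def U_def Gr_def vimage_def)
  also have "\<dots> \<le> measure_pmf.prob (Pi_pmf (\<Union>e\<in>pairs t. D e) False (\<lambda>_. bernoulli_pmf p))
      {b. U (\<lambda>e. e \<in> pairs t \<and> (\<exists>d\<in>D e. b d))}"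
  proof (rule prob_Pi_bernoulli_blocks[OF finite_pairs p q])
    fix e assume "e \<in> pairs t"
    then obtain i j where "i < t" "j < t" "i \<noteq> j" "e = {i, j}" by (auto simp: pairs_def)
    then show "finite (D e) \<and> (1 - p) ^ card (D e) \<le> 1 - q"
      using pq finB disj by (simp add: D finite_cross_pairs card_cross_pairs)
  next
    fix e e' assume e: "e \<in> pairs t" "e' \<in> pairs t" "e \<noteq> e'"
    then obtain i j i' j' where ij: "i < t" "j < t" "i \<noteq> j" "e = {i, j}"
      "i' < t" "j' < t" "i' \<noteq> j'" "e' = {i', j'}" by (auto simp: pairs_def)
    \<comment> \<open>A vertex determines its block, so a cross pair determines the pair of blocks
      that it joins.\<close>
    have same: "k = l" if "z \<in> B k" "z \<in> B l" "k < t" "l < t" for z k l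
      using disj[of k l] that by blast
    show "D e \<inter> D e' = {}"
    proof (rule ccontr)
      assume "D e \<inter> D e' \<noteq> {}"
      then obtain z y z' y' where zy: "z \<in> B i" "y \<in> B j" "z' \<in> B i'" "y' \<in> B j'" "{z, y} = {z', y'}"
        using ij by (fastforce simp: D cross_pairs_iff)
      then have "{i, j} = {i', j'}"
        using same ij unfolding doubleton_eq_iff by metis
      then show False using e ij by simp
    qed
  next
    fix b b' :: "nat set \<Rightarrow> bool" assume b: "\<And>e. b e \<Longrightarrow> b' e" "U b"
    \<comment> \<open>A spanning subgraph is a minor with singleton branch sets, which makes
      \<open>U\<close> increasing.\<close>
    have "is_minor (Gr b) (Gr b')"
      unfolding is_minor_def
      using b by (intro exI[of _ "\<lambda>v. {v}"]) (auto simp: Gr_def connected_on_singleton)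
    then have "f (Gr b) \<le> f (Gr b')"
      using f graph_Gr unfolding minor_monotone_def by blast
    then show "U b'" using b by (simp add: U_def)
  qed
  also have "\<dots> = measure_pmf.prob (Pi_pmf (pairs n) False (\<lambda>_. bernoulli_pmf p))
      {b. U (\<lambda>e. e \<in> pairs t \<and> (\<exists>d\<in>D e. b d))}"
  proof -
    \<comment> \<open>Passing to all of \<open>pairs n\<close> only adds bits outside the sets
      \<open>D e\<close>, and the event ignores these.\<close>
    have eq: "(\<lambda>e. e \<in> pairs t \<and> (\<exists>d\<in>D e. if d \<in> (\<Union>e\<in>pairs t. D e) then b d else False)) =
        (\<lambda>e. e \<in> pairs t \<and> (\<exists>d\<in>D e. b d))" for b
      by (auto simp: fun_eq_iff)
    show ?thesis
      unfolding Pi_pmf_subset[OF finite_pairs Dpairs] measure_map_pmf vimage_def mem_Collect_eq eq ..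
  qed
  also have "\<dots> \<le> measure_pmf.prob (Pi_pmf (pairs n) False (\<lambda>_. bernoulli_pmf p))
      {b. x \<le> f (fst R, snd R \<union> {e \<in> pairs n. b e})}"
  proof (intro measure_pmf.finite_measure_mono subsetI CollectI)
    fix b assume "b \<in> {b. U (\<lambda>e. e \<in> pairs t \<and> (\<exists>d\<in>D e. b d))}"
    then have le: "x \<le> f (Gr (\<lambda>e. e \<in> pairs t \<and> (\<exists>d\<in>D e. b d)))" (is "_ \<le> f ?G")
      by (simp add: U_def)
    let ?R = "(fst R, snd R \<union> {e \<in> pairs n. b e})"
    have "is_graph ?R" using R by (auto simp: is_graph_def pairs_def)
    moreover have "is_minor ?G ?R"
      unfolding is_minor_def
    proof (intro exI[of _ B] conjI ballI allI impI)
      fix v assume "v \<in> fst ?G"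
      then have v: "v < t" by (simp add: Gr_def)
      show "B v \<noteq> {}" "B v \<subseteq> fst ?R" using B[OF v] R by auto
      show "connected_on ?R (B v)" using B[OF v] by (auto intro: connected_on_mono)
    next
      fix u v assume "u \<in> fst ?G" "v \<in> fst ?G" "u \<noteq> v"
      then show "B u \<inter> B v = {}" using disj by (simp add: Gr_def)
    next
      fix u v assume uv: "{u, v} \<in> snd ?G"
      then have "{u, v} \<in> pairs t" by (simp add: Gr_def)
      then have "u \<noteq> v" by (auto simp: pairs_def)
      from uv obtain d where d: "{u, v} \<in> pairs t" "d \<in> D {u, v}" "b d" by (auto simp: Gr_def)
      then obtain y z where "y \<in> B u" "z \<in> B v" "d = {y, z}"
        using D[OF \<open>u \<noteq> v\<close>] by (auto simp: cross_pairs_iff)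
      moreover have "d \<in> pairs n" using d Dpairs by blast
      ultimately show "\<exists>y\<in>B u. \<exists>z\<in>B v. {y, z} \<in> snd ?R" using d(3) by auto
    qed
    ultimately have "f ?G \<le> f ?R"
      using f graph_Gr unfolding minor_monotone_def by blast
    with le show "x \<le> f ?R" by linarith
  qed simp
  finally show ?thesis .
qed

section \<open>The block minor of the union\<close>

text \<open>The bound for fixed \<open>n\<close> behind both cases of the theorem; for this reason
  the threshold \<open>x\<close> is arbitrary. The factor \<open>1 - exp (- N / 200)\<close>
  accounts for the first round, and the probability for \<open>gnp\<close> on the left for the
  second.\<close>

lemma prob_gnp_union_ge:
  fixes C p x :: real and n \<Delta> :: nat
  assumes f: "minor_monotone f"
    and H: "connected_graph H" "fst H = {..<n}"
    and \<Delta>: "\<Delta> = max_degree H" "1 \<le> \<Delta>" "real \<Delta> \<le> (real n)\<^sup>2 * p / (9600 * C)"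
    and C: "10 \<le> C" and p: "0 < p" "p \<le> 2 / real n"
  shows "(1 - exp (- ((real n)\<^sup>2 * p) / 200)) *
      measure_pmf.prob (gnp (nat \<lfloor>(real n)\<^sup>2 * p / (19200 * C * \<Delta>)\<rfloor>)
        (1 - exp (- ((96 * C * \<Delta>)\<^sup>2 / ((real n)\<^sup>2 * p))))) {G. x \<le> f G} \<le>
    measure_pmf.prob (gnp n p) {G. x \<le> f (graph_union H G)}"
proof -
  define N where "N = (real n)\<^sup>2 * p"
  define \<kappa> where "\<kappa> = C / (real n * p)"
  define t where "t = nat \<lfloor>N / (19200 * C * \<Delta>)\<rfloor>"
  define q where "q = 1 - exp (- ((96 * C * \<Delta>)\<^sup>2 / N))"
  define s where "s = nat \<lceil>8 * \<kappa>\<rceil>"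
  \<comment> \<open>The density that makes two independent rounds amount to exactly
    \<open>p\<close>; it is at least \<open>p / 2\<close>.\<close>
  define p1 where "p1 = 1 - sqrt (1 - p)"
  \<comment> \<open>Two blocks of size \<open>K\<close> have \<open>K * K\<close> cross pairs, and
    \<open>p / 2 * (K * K) = 18432 * (p * (\<kappa> * \<Delta>)\<^sup>2)\<close> is twice the
    required exponent \<open>M = 9216 * (p * (\<kappa> * \<Delta>)\<^sup>2)\<close>.\<close>
  define K where "K = 192 * (\<kappa> * \<Delta>)"
  define b where "b = real \<Delta> * s"
  have n: "0 < n" using H by (cases n) (auto simp: connected_graph_def)
  have np: "0 < real n * p" "real n * p \<le> 2" using n p by (auto simp: field_simps)
  have Nn: "N = real n * (real n * p)" by (simp add: N_def power2_eq_square)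
  have Npos: "0 < N" using Nn n np by simp
  have \<kappa>np: "\<kappa> * (real n * p) = C" unfolding \<kappa>_def using n p by simp
  have \<kappa>5: "5 \<le> \<kappa>"
  proof -
    have "10 \<le> \<kappa> * (real n * p)" using \<kappa>np C by simp
    moreover have "\<kappa> * (real n * p) \<le> \<kappa> * 2"
      using C np by (intro mult_left_mono) (auto simp: \<kappa>_def)
    ultimately show ?thesis by simp
  qed
  have N\<kappa>: "N * \<kappa> = real n * C" using \<kappa>np Nn by (simp add: mult.assoc mult.commute)
  have \<kappa>\<Delta>: "9600 * (\<kappa> * \<Delta>) \<le> real n"
  proof -
    have "real \<Delta> * (9600 * C) \<le> N" using \<Delta>(3) C by (simp add: N_def field_simps)
    then have "9600 * (\<kappa> * \<Delta>) * (real n * p) \<le> real n * (real n * p)"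
      unfolding Nn \<kappa>np[symmetric] by (simp add: algebra_simps)
    then show ?thesis using np(1) mult_le_cancel_right_pos by blast
  qed
  have p1: "p \<le> 1"
  proof -
    have "5 * 1 \<le> \<kappa> * \<Delta>" using \<kappa>5 \<Delta>(2) by (intro mult_mono) auto
    then have "2 \<le> real n" using \<kappa>\<Delta> by linarith
    then have "2 / real n \<le> 1" by simp
    then show ?thesis using p(2) by linarith
  qed
  \<comment> \<open>Rounding up adds at most 1, which is less than \<open>\<kappa>\<close>.\<close>
  have s: "8 * \<kappa> \<le> s" "real s \<le> 9 * \<kappa>" "1 \<le> s"
    unfolding s_def using \<kappa>5 by linarith+
  have p1p: "0 \<le> p1" "p1 \<le> 1" "p / 2 \<le> p1" "1 - p = (1 - p1)\<^sup>2"
  proof -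
    have "1 - p \<le> (1 - p / 2)\<^sup>2" using p by (simp add: power2_eq_square algebra_simps)
    then have "sqrt (1 - p) \<le> 1 - p / 2" using p1 by (intro real_le_lsqrt) auto
    then show "p / 2 \<le> p1" by (simp add: p1_def)
    then show "0 \<le> p1" using p by linarith
    show "p1 \<le> 1" "1 - p = (1 - p1)\<^sup>2" using p1 by (auto simp: p1_def)
  qed
  have q: "0 \<le> q" "q \<le> 1" using Npos by (auto simp: q_def)
  have graphH: "is_graph H" and connH: "connected_on H {..<n}"
    using H by (auto simp: connected_graph_def)
  have deg: "finite {u. {v, u} \<in> snd H} \<and> card {u. {v, u} \<in> snd H} \<le> \<Delta>" if "v \<in> {..<n}" for v
  proof
    show "finite {u. {v, u} \<in> snd H}"
    proof (rule finite_subset)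
      show "{u. {v, u} \<in> snd H} \<subseteq> fst H"
        using graphH unfolding is_graph_def by (fastforce simp: doubleton_eq_iff)
    qed (simp add: H)
    show "card {u. {v, u} \<in> snd H} \<le> \<Delta>"
      using that H(2) unfolding \<Delta>(1) max_degree_def degree_def by (intro Max_ge) auto
  qed
  obtain F where F: "finite F" "disjoint F" "n < card (\<Union>F) + s"
    and parts: "\<And>A. A \<in> F \<Longrightarrow> A \<subseteq> {..<n} \<and> connected_on H A \<and> s \<le> card A \<and>
      card A \<le> 1 + \<Delta> * (s - 1)"
    using ex_small_parts[OF finite_lessThan connH s(3) deg] by auto
  have cardb: "real (card A) \<le> b" if "A \<in> F" for A
  proof -
    have "\<Delta> * s = \<Delta> * (s - 1) + \<Delta>" using s(3) by (cases s) auto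
    then have "card A \<le> \<Delta> * s" using parts[OF that] \<Delta>(2) by linarith
    then have "real (card A) \<le> real (\<Delta> * s)" by (rule of_nat_mono)
    then show ?thesis by (simp add: b_def)
  qed
  \<comment> \<open>Disjoint parts of size at least \<open>8 * \<kappa>\<close> number at most
    \<open>n / (8 * \<kappa>) = N / (8 * C)\<close>, and \<open>C\<close> is at least 10.\<close>
  have cardF: "80 * real (card F) \<le> N"
  proof -
    have "card F * s \<le> (\<Sum>A\<in>F. card A)" using parts by (intro sum_bounded_below[of F s card, simplified]) auto
    also have "\<dots> = card (\<Union>F)"
      using F(2) parts
      by (intro card_Union_disjoint[symmetric]) (auto intro: finite_subset)
    also have "\<dots> \<le> card {..<n}" using parts by (intro card_mono) auto
    finally have "real (card F) * s \<le> n" by (simp flip: of_nat_mult)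
    moreover have "real (card F) * (8 * \<kappa>) \<le> real (card F) * s" using s by (intro mult_left_mono) auto
    ultimately have "8 * (real (card F) * \<kappa>) \<le> n" by linarith
    then have "8 * (real (card F) * \<kappa>) * C \<le> N * \<kappa>" unfolding N\<kappa> using C by (intro mult_right_mono) auto
    then have "8 * real (card F) * C \<le> N" using \<kappa>5 by (simp add: field_simps)
    moreover have "real (card F) * 10 \<le> real (card F) * C" using C by (intro mult_left_mono) auto
    ultimately show ?thesis by linarith
  qed
  define J where "J = {e. \<forall>X Y. X \<subseteq> F \<longrightarrow> Y \<subseteq> F \<longrightarrow> X \<inter> Y = {} \<longrightarrow> real n / 4 \<le> card (\<Union>X) \<longrightarrow>
      real n / 4 \<le> card (\<Union>Y) \<longrightarrow> (\<exists>x\<in>\<Union>X. \<exists>y\<in>\<Union>Y. e {x, y})}"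
  let ?M = "Pi_pmf (pairs n) False (\<lambda>_. bernoulli_pmf p1)"
  have probJ: "1 - exp (- N / 200) \<le> measure_pmf.prob ?M J"
  proof -
    have "1 - 4 ^ card F * exp (- p1 * (real n / 4)\<^sup>2) \<le> measure_pmf.prob ?M J"
      unfolding J_def by (rule prob_joined) (use F parts p1p in auto)
    \<comment> \<open>The number of subfamily pairs is at most \<open>exp (N / 40)\<close> and each
      fails with probability at most \<open>exp (- N / 32)\<close>; finally
      \<open>1/32 - 1/40 = 1/160\<close>, which exceeds \<open>1/200\<close>.\<close>
    moreover have "4 ^ card F * exp (- p1 * (real n / 4)\<^sup>2) \<le> exp (- N / 200)"
    proof -
      have "(2::real) \<le> exp 1" using exp_ge_add_one_self[of 1] by simp
      then have "(2::real) * 2 \<le> exp 1 * exp 1" by (intro mult_mono) auto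
      then have "(4::real) \<le> exp 2" by (simp add: exp_add[symmetric])
      then have "(4::real) ^ card F \<le> exp 2 ^ card F" by (intro power_mono) auto
      also have "\<dots> = exp (2 * real (card F))" by (simp add: exp_of_nat2_mult)
      also have "\<dots> \<le> exp (N / 40)" using cardF by simp
      finally have 1: "(4::real) ^ card F \<le> exp (N / 40)" .
      have "p / 2 * (real n / 4)\<^sup>2 \<le> p1 * (real n / 4)\<^sup>2" using p1p by (intro mult_right_mono) auto
      then have "N / 32 \<le> p1 * (real n / 4)\<^sup>2" by (simp add: N_def power2_eq_square field_simps)
      then have "exp (- p1 * (real n / 4)\<^sup>2) \<le> exp (- N / 32)" by simp
      with 1 have "4 ^ card F * exp (- p1 * (real n / 4)\<^sup>2) \<le> exp (N / 40) * exp (- N / 32)"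
        by (intro mult_mono) auto
      also have "\<dots> = exp (N / 40 - N / 32)" by (simp add: exp_add[symmetric])
      also have "\<dots> \<le> exp (- N / 200)" using Npos by simp
      finally show ?thesis .
    qed
    ultimately show ?thesis by linarith
  qed
  have tle: "real t * (19200 * (\<kappa> * \<Delta>)) \<le> real n"
  proof -
    have pos: "0 < 19200 * C * \<Delta>" using C \<Delta>(2) by simp
    then have "0 \<le> N / (19200 * C * \<Delta>)" using Npos by (intro divide_nonneg_pos) auto
    then have "real t \<le> N / (19200 * C * \<Delta>)" unfolding t_def by simp
    then have "real t * (19200 * C * \<Delta>) \<le> N" using pos pos_le_divide_eq by blast
    then have "real t * (19200 * (\<kappa> * \<Delta>)) * (real n * p) \<le> real n * (real n * p)"
      unfolding Nn \<kappa>np[symmetric] by (simp add: algebra_simps)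
    then show ?thesis using np(1) mult_le_cancel_right_pos by blast
  qed
  have bK: "0 \<le> b" "b \<le> 9 * (\<kappa> * \<Delta>)" "0 < K"
  proof -
    show "0 \<le> b" by (simp add: b_def)
    have "real \<Delta> * s \<le> real \<Delta> * (9 * \<kappa>)" using s by (intro mult_left_mono) auto
    then show "b \<le> 9 * (\<kappa> * \<Delta>)" by (simp add: b_def mult_ac)
    show "0 < K" using \<kappa>5 \<Delta>(2) by (simp add: K_def)
  qed
  \<comment> \<open>Since \<open>K + b \<le> 201 * (\<kappa> * \<Delta>)\<close>, the blocks need at
    most \<open>201/19200\<close> of the \<open>n\<close> vertices. The uncovered vertices and the
    term \<open>b\<close> cost at most \<open>18 * (\<kappa> * \<Delta>)\<close>, hence at most
    \<open>18/9600\<close> of them. Both fit into the half that remains after subtracting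
    \<open>2 * (n / 4)\<close>.\<close>
  have room: "real t * (K + b) \<le> card (\<Union>F) - 2 * (real n / 4) - b"
  proof -
    have "real t * (K + b) \<le> real t * (201 * (\<kappa> * \<Delta>))"
      using bK by (intro mult_left_mono) (auto simp: K_def)
    then have 1: "real t * (K + b) \<le> 201 / 19200 * real n" using tle by simp
    have "\<kappa> * 1 \<le> \<kappa> * \<Delta>" using \<kappa>5 \<Delta>(2) by (intro mult_left_mono) auto
    then have 2: "real s \<le> 9 * (\<kappa> * \<Delta>)" using s by linarith
    have "real n \<le> real (card (\<Union>F)) + s" using F(3) by linarith
    with 1 2 bK(2) \<kappa>\<Delta> show ?thesis by simp
  qed
  \<comment> \<open>The first round is fixed to a good outcome \<open>e0\<close>. The blocks may
    depend on \<open>e0\<close>, as the second round is independent of it.\<close>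
  have main: "measure_pmf.prob (gnp t q) {G. x \<le> f G} \<le> measure_pmf.prob
      (map_pmf (\<lambda>e' e. e \<in> pairs n \<and> (e0 e \<or> e' e)) ?M)
      {e. x \<le> f (graph_union H ({..<n}, {d \<in> pairs n. e d}))}" if e0: "e0 \<in> J" for e0
  proof -
    define R where "R = (fst H, snd H \<union> {e \<in> pairs n. e0 e})"
    have R: "is_graph R" "fst R = {..<n}"
      using graphH H(2) by (auto simp: R_def is_graph_def pairs_def)
    have "\<exists>B :: nat \<Rightarrow> nat set. (\<forall>i<t. B i \<subseteq> \<Union>F \<and> connected_on R (B i) \<and> K \<le> card (B i)) \<and>
        (\<forall>i<t. \<forall>j<t. i \<noteq> j \<longrightarrow> B i \<inter> B j = {})"
    proof (rule ex_connected_blocks[OF F(1,2) _ _ bK(1) _ _ room])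
      fix A assume A: "A \<in> F"
      have "connected_on R A" using parts[OF A] by (auto simp: R_def intro: connected_on_mono)
      then show "finite A \<and> connected_on R A \<and> real (card A) \<le> b"
        using parts[OF A] cardb[OF A] finite_subset by blast
    next
      fix X Y assume XY: "X \<subseteq> F" "Y \<subseteq> F" "X \<inter> Y = {}" "real n / 4 \<le> card (\<Union>X)"
        "real n / 4 \<le> card (\<Union>Y)"
      then obtain x y where xy: "x \<in> \<Union>X" "y \<in> \<Union>Y" "e0 {x, y}"
        using e0 unfolding J_def by blast
      have "x \<noteq> y" using disjoint_Union_Int[OF F(2) XY(1-3)] xy by blast
      moreover have "x < n" "y < n" using xy XY(1,2) parts by auto
      ultimately have "{x, y} \<in> snd R" using xy by (auto simp: R_def pairs_def)
      then show "\<exists>x\<in>\<Union>X. \<exists>y\<in>\<Union>Y. {x, y} \<in> snd R" using xy by blast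
    qed (use n bK in auto)
    then obtain B :: "nat \<Rightarrow> nat set" where
      B: "\<forall>i<t. B i \<subseteq> \<Union>F \<and> connected_on R (B i) \<and> K \<le> card (B i)"
      and disj: "\<forall>i<t. \<forall>j<t. i \<noteq> j \<longrightarrow> B i \<inter> B j = {}" by (elim exE conjE)
    have "measure_pmf.prob (gnp t q) {G. x \<le> f G} \<le> measure_pmf.prob ?M
        {e'. x \<le> f (fst R, snd R \<union> {e \<in> pairs n. e' e})}"
    proof (rule prob_gnp_le_blocks[OF f R _ _ p1p(1,2) q])
      fix i assume "i < t"
      then have "B i \<subseteq> \<Union>F" "connected_on R (B i)" "K \<le> card (B i)" using B by auto
      moreover have "B i \<noteq> {}" using bK(3) \<open>K \<le> card (B i)\<close> by auto
      moreover have "\<Union>F \<subseteq> {..<n}" using parts by blast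
      ultimately show "B i \<noteq> {} \<and> B i \<subseteq> {..<n} \<and> connected_on R (B i)" by blast
    next
      fix i j assume ij: "i < t" "j < t" "i \<noteq> j"
      then show "B i \<inter> B j = {}" using disj by blast
      have "K * K \<le> real (card (B i)) * card (B j)"
        using B ij bK(3) by (intro mult_mono) auto
      then have "p / 2 * (K * K) \<le> p1 * (real (card (B i)) * card (B j))"
        using p1p p bK(3) by (intro mult_mono[of "p / 2" p1]) auto
      moreover have "(96 * C * \<Delta>)\<^sup>2 / N \<le> p / 2 * (K * K)"
      proof -
        have "(96 * C * \<Delta>)\<^sup>2 / N = 96\<^sup>2 * p * (\<kappa> * \<Delta>)\<^sup>2"
          unfolding \<kappa>np[symmetric] Nn using np(1) n p(1) by (simp add: power2_eq_square field_simps)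
        also have "\<dots> = 9216 * (p * (\<kappa> * \<Delta>)\<^sup>2)" by simp
        also have "\<dots> \<le> 18432 * (p * (\<kappa> * \<Delta>)\<^sup>2)" using p(1) by (intro mult_right_mono) auto
        also have "\<dots> = p / 2 * (K * K)" by (simp add: K_def power2_eq_square)
        finally show ?thesis .
      qed
      ultimately have "(96 * C * \<Delta>)\<^sup>2 / N \<le> p1 * real (card (B i) * card (B j))"
        unfolding of_nat_mult by linarith
      then have "exp (- p1 * real (card (B i) * card (B j))) \<le> 1 - q" by (simp add: q_def)
      then show "(1 - p1) ^ (card (B i) * card (B j)) \<le> 1 - q"
        using one_minus_power_le_exp[OF p1p(1,2), of "card (B i) * card (B j)"] by linarith
    qed
    also have "{e'. x \<le> f (fst R, snd R \<union> {e \<in> pairs n. e' e})} =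
        {e'. x \<le> f (graph_union H ({..<n}, {d \<in> pairs n. d \<in> pairs n \<and> (e0 d \<or> e' d)}))}"
    proof -
      have "(fst R, snd R \<union> {e \<in> pairs n. e' e}) =
          graph_union H ({..<n}, {d \<in> pairs n. d \<in> pairs n \<and> (e0 d \<or> e' d)})" for e'
        by (auto simp: R_def graph_union_def)
      then show ?thesis by simp
    qed
    finally show ?thesis by (simp add: vimage_def)
  qed
  have "(1 - exp (- N / 200)) * measure_pmf.prob (gnp t q) {G. x \<le> f G} \<le>
      measure_pmf.prob ?M J * measure_pmf.prob (gnp t q) {G. x \<le> f G}"
    using probJ by (intro mult_right_mono) auto
  also have "\<dots> \<le> measure_pmf.prob (bind_pmf ?M (\<lambda>e0. map_pmf (\<lambda>e' e. e \<in> pairs n \<and> (e0 e \<or> e' e)) ?M))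
      {e. x \<le> f (graph_union H ({..<n}, {d \<in> pairs n. e d}))}"
    by (rule measure_bind_pmf_ge[OF main])
  also have "\<dots> = measure_pmf.prob (gnp n p) {G. x \<le> f (graph_union H G)}"
    unfolding Pi_bernoulli_sprinkle[OF finite_pairs p1p(1,2,4), symmetric]
    by (simp add: gnp_def vimage_def)
  finally show ?thesis by (simp add: N_def t_def q_def)
qed

section \<open>Asymptotics\<close>

text \<open>The definition speaks of one density per vertex number, whereas the block graphs may
  have the same \<open>t\<close> for several \<open>n\<close> with different densities. Choosing a
  worst density for each \<open>m\<close> makes the bound uniform: a violation at \<open>m\<close>
  would be one along the chosen sequence.\<close>

lemma bounded_below_uniform:
  assumes bb: "bounded_below f c r ft" and \<epsilon>: "0 < \<epsilon>"
  obtains T :: nat where "\<And>m q. T \<le> m \<Longrightarrow> c / real m \<le> q \<Longrightarrow> q \<le> 1 \<Longrightarrow>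
      1 - \<epsilon> \<le> measure_pmf.prob (gnp m q) {G. r * ft m q \<le> f G}"
proof -
  define bad where "bad m q \<longleftrightarrow> c / real m \<le> q \<and> q \<le> 1 \<and>
    measure_pmf.prob (gnp m q) {G. r * ft m q \<le> f G} < 1 - \<epsilon>" for m :: nat and q
  \<comment> \<open>Without a bad density the value 1 is taken, which is admissible once
    \<open>c / m < 1\<close>.\<close>
  define q where "q m = (if \<exists>q. bad m q then SOME q. bad m q else 1)" for m
  have q: "bad m (q m)" if "bad m q'" for m q'
    using someI[of "bad m" q'] that by (auto simp: q_def)
  have "((\<lambda>m. c / real m) \<longlongrightarrow> 0) sequentially" by real_asymp
  then have "\<forall>\<^sub>F m in sequentially. c / real m < 1" by (rule order_tendstoD) simp
  then have "\<forall>\<^sub>F m in sequentially. c / real m \<le> q m \<and> q m \<le> 1"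
  proof eventually_elim
    case (elim m)
    show ?case
    proof (cases "\<exists>q'. bad m q'")
      case True
      then have "bad m (q m)" using q by blast
      then show ?thesis by (simp add: bad_def)
    qed (use elim in \<open>auto simp: q_def\<close>)
  qed
  then have "(\<lambda>m. measure_pmf.prob (gnp m (q m)) {G. f G \<ge> r * ft m (q m)}) \<longlonglongrightarrow> 1"
    using bb by (simp add: bounded_below_def)
  then have "\<forall>\<^sub>F m in sequentially. 1 - \<epsilon> < measure_pmf.prob (gnp m (q m)) {G. r * ft m (q m) \<le> f G}"
    using \<epsilon> by (auto dest: order_tendstoD(1)[of _ _ _ "1 - \<epsilon>"])
  then obtain T where T: "\<And>m. T \<le> m \<Longrightarrow>
      1 - \<epsilon> < measure_pmf.prob (gnp m (q m)) {G. r * ft m (q m) \<le> f G}"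
    by (auto simp: eventually_sequentially)
  have good: "\<not> bad m q'" if "T \<le> m" for m q'
  proof
    assume "bad m q'"
    from q[OF this] T[OF that] show False by (simp add: bad_def)
  qed
  show ?thesis
    by (rule that[of T]) (use good in \<open>force simp: bad_def not_less\<close>)
qed

text \<open>A union bound over the fewer than \<open>t\<^sup>2\<close> pairs that might be missing;
  if none is, the graph is complete.\<close>

lemma prob_gnp_complete_ge:
  fixes f :: "ugraph \<Rightarrow> real"
  assumes q: "0 \<le> q" "q \<le> 1"
  shows "1 - (real t)\<^sup>2 * (1 - q) \<le> measure_pmf.prob (gnp t q) {G. f (complete_graph t) \<le> f G}"
proof -
  let ?M = "Pi_pmf (pairs t) False (\<lambda>_. bernoulli_pmf q)"
  let ?S = "{b. f (complete_graph t) \<le> f ({..<t}, {e \<in> pairs t. b e})}"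
  have "card (pairs t) \<le> card ((\<lambda>(x, y). {x, y}) ` ({..<t} \<times> {..<t}))"
    by (intro card_mono) (auto simp: pairs_def)
  also have "\<dots> \<le> card ({..<t} \<times> {..<t})" by (intro card_image_le) auto
  also have "\<dots> = t\<^sup>2" by (simp add: power2_eq_square)
  finally have card: "real (card (pairs t)) \<le> (real t)\<^sup>2" by (metis of_nat_le_iff of_nat_power)
  have "- ?S \<subseteq> (\<Union>e\<in>pairs t. {b. \<forall>d\<in>{e}. \<not> b d})"
  proof
    fix b assume b: "b \<in> - ?S"
    have "\<exists>e\<in>pairs t. \<not> b e"
    proof (rule ccontr)
      assume "\<not> ?thesis"
      then have "{e \<in> pairs t. b e} = pairs t" by blast
      moreover have "complete_graph t = ({..<t}, pairs t)" by (simp add: complete_graph_def pairs_def)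
      ultimately show False using b by simp
    qed
    then show "b \<in> (\<Union>e\<in>pairs t. {b. \<forall>d\<in>{e}. \<not> b d})" by auto
  qed
  then have "measure_pmf.prob ?M (- ?S) \<le> measure_pmf.prob ?M (\<Union>e\<in>pairs t. {b. \<forall>d\<in>{e}. \<not> b d})"
    by (intro measure_pmf.finite_measure_mono) auto
  also have "\<dots> \<le> (\<Sum>e\<in>pairs t. measure_pmf.prob ?M {b. \<forall>d\<in>{e}. \<not> b d})"
    using finite_pairs by (intro measure_pmf.finite_measure_subadditive_finite) auto
  also have "\<dots> = (\<Sum>e\<in>pairs t. 1 - q)"
    by (intro sum.cong refl) (subst prob_Pi_bernoulli_none[OF finite_pairs _ q], auto)
  also have "\<dots> \<le> (real t)\<^sup>2 * (1 - q)" using card q by (simp add: mult_right_mono)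
  finally have "1 - (real t)\<^sup>2 * (1 - q) \<le> measure_pmf.prob ?M ?S"
    using measure_pmf.prob_compl[of ?S ?M] by (simp add: Compl_eq_Diff_UNIV)
  then show ?thesis by (simp add: gnp_def vimage_def)
qed

text \<open>Makes \<open>bounded_below\<close> applicable to the block graph, uniformly in
  \<open>\<Delta>\<close>. The upper bound on \<open>\<Delta>\<close> forces many blocks. Their
  number times \<open>M\<close> is of order \<open>C * \<Delta>\<close>, which gives density at
  least \<open>c / t\<close> when \<open>M\<close> is small; for large \<open>M\<close> the density
  is at least 1/2.\<close>

lemma eventually_block_density:
  fixes c C :: real and T :: nat
  assumes c: "1 < c" and C: "10 * c \<le> C"
  shows "\<forall>\<^sub>F N in at_top. \<forall>\<Delta>. 1 \<le> \<Delta> \<longrightarrow> \<Delta> \<le> sqrt (N * ln N) \<longrightarrow>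
    T \<le> nat \<lfloor>N / (19200 * C * \<Delta>)\<rfloor> \<and>
    c / real (nat \<lfloor>N / (19200 * C * \<Delta>)\<rfloor>) \<le> 1 - exp (- ((96 * C * \<Delta>)\<^sup>2 / N))"
proof -
  \<comment> \<open>The summand 1 absorbs the floor, \<open>T\<close> is the required number of
    blocks, and \<open>2 * c\<close> serves the case of density 1/2.\<close>
  define Z where "Z = real T + 2 * c + 1"
  have Cpos: "0 < C" using c C by simp
  have "filterlim (\<lambda>N::real. N / sqrt (N * ln N)) at_top at_top" by real_asymp
  then have "\<forall>\<^sub>F N::real in at_top. 19200 * C * Z \<le> N / sqrt (N * ln N)"
    by (simp add: filterlim_at_top)
  moreover have "\<forall>\<^sub>F N::real in at_top. 1 < N" by (rule eventually_gt_at_top)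
  ultimately show ?thesis
  proof eventually_elim
    case (elim N)
    show ?case
    proof (intro allI impI)
      fix \<Delta> :: real assume \<Delta>: "1 \<le> \<Delta>" "\<Delta> \<le> sqrt (N * ln N)"
      define y where "y = N / (19200 * C * \<Delta>)"
      define t where "t = nat \<lfloor>y\<rfloor>"
      define M where "M = (96 * C * \<Delta>)\<^sup>2 / N"
      have "N / sqrt (N * ln N) \<le> N / \<Delta>" using \<Delta> elim by (intro divide_left_mono) auto
      with elim have "19200 * C * Z \<le> N / \<Delta>" by linarith
      then have y: "Z \<le> y" using Cpos \<Delta> by (simp add: y_def field_simps)
      then have t: "y - 1 \<le> real t" "real T + 2 * c \<le> real t"
        unfolding t_def Z_def using c by linarith+
      have half: "y / 2 \<le> real t" using t c y by (simp add: Z_def)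
      have tpos: "0 < real t" using t c by linarith
      have Mpos: "0 < M" using Cpos \<Delta> elim by (simp add: M_def)
      have "c \<le> real t * (1 - exp (- M))"
      proof (cases "M \<le> 1")
        case True
        have "M / 2 \<le> 1 - exp (- M)"
        proof -
          have "exp (- M) \<le> 1 / (1 + M)"
            using exp_ge_add_one_self[of M] Mpos by (simp add: exp_minus field_simps)
          also have "\<dots> \<le> 1 - M / 2"
            using True Mpos mult_left_mono[of M 1 M] by (simp add: field_simps)
          finally show ?thesis by simp
        qed
        then have "y / 2 * (M / 2) \<le> real t * (1 - exp (- M))"
          using half Mpos tpos by (intro mult_mono) auto
        \<comment> \<open>The constant is \<open>96\<^sup>2 / (4 * 19200) = 0.12\<close>, so
          \<open>C \<ge> 10 * c\<close> yields at least \<open>1.2 * c\<close>.\<close>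
        moreover have "y / 2 * (M / 2) = 9216 / 76800 * (C * \<Delta>)"
          using Cpos \<Delta> elim by (simp add: y_def M_def power2_eq_square field_simps)
        moreover have "10 * c * 1 \<le> C * \<Delta>" using C c \<Delta> by (intro mult_mono) auto
        ultimately show ?thesis using c by linarith
      next
        case False
        have "exp (- M) \<le> exp (- 1)" using False by simp
        also have "\<dots> \<le> (1 / 2 :: real)"
          using exp_ge_add_one_self[of "1 :: real"] by (simp add: exp_minus field_simps)
        finally have "2 * c * (1 / 2) \<le> real t * (1 - exp (- M))"
          using t c by (intro mult_mono) auto
        then show ?thesis by simp
      qed
      then have "c / real t \<le> 1 - exp (- M)" using tpos by (simp add: field_simps)
      moreover have "T \<le> t" using t c by linarith
      ultimately show "T \<le> nat \<lfloor>N / (19200 * C * \<Delta>)\<rfloor> \<and>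
          c / real (nat \<lfloor>N / (19200 * C * \<Delta>)\<rfloor>) \<le> 1 - exp (- ((96 * C * \<Delta>)\<^sup>2 / N))"
        by (simp add: t_def y_def M_def)
    qed
  qed
qed

text \<open>Here \<open>t \<le> N\<close>, while \<open>\<Delta>\<^sup>2 > N ln N\<close> makes the
  exponent at least \<open>3 * ln N\<close>. So each pair is missing with probability at most
  \<open>1 / N ^ 3\<close>, against at most \<open>N\<^sup>2\<close> pairs.\<close>

lemma complete_block_density:
  fixes C N \<Delta> :: real
  assumes N: "1 < N" and C: "10 \<le> C" and \<Delta>: "1 \<le> \<Delta>" "sqrt (N * ln N) < \<Delta>"
  shows "(real (nat \<lfloor>N / (19200 * C * \<Delta>)\<rfloor>))\<^sup>2 * exp (- ((96 * C * \<Delta>)\<^sup>2 / N)) \<le> 1 / N"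
proof -
  define t where "t = nat \<lfloor>N / (19200 * C * \<Delta>)\<rfloor>"
  define M where "M = (96 * C * \<Delta>)\<^sup>2 / N"
  have CD: "10 * 1 \<le> C * \<Delta>" using C \<Delta> by (intro mult_mono) auto
  have "0 \<le> N / (19200 * C * \<Delta>)" using N CD by (intro divide_nonneg_nonneg) auto
  then have "real t \<le> N / (19200 * C * \<Delta>)" by (simp add: t_def)
  also have "\<dots> \<le> N / 1" using N CD by (intro divide_left_mono) auto
  finally have t: "(real t)\<^sup>2 \<le> N\<^sup>2" by (intro power_mono) auto
  have "(sqrt (N * ln N))\<^sup>2 \<le> \<Delta>\<^sup>2" using \<Delta> N by (intro power_mono) auto
  then have 1: "N * ln N \<le> \<Delta>\<^sup>2" using N by simp
  have "3 * 1 \<le> (96 * C)\<^sup>2"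
    using C power_mono[of 10 "96 * C" 2] by simp
  then have "3 * (N * ln N) \<le> (96 * C)\<^sup>2 * \<Delta>\<^sup>2" using 1 N by (intro mult_mono) auto
  then have "3 * ln N \<le> M" using N by (simp add: M_def power_mult_distrib field_simps)
  then have "exp (- M) \<le> exp (- (3 * ln N))" by simp
  also have "\<dots> = 1 / N ^ 3"
  proof -
    have "3 * ln N = ln (N ^ 3)" using N by (simp add: ln_realpow)
    then show ?thesis using N by (simp add: exp_minus inverse_eq_divide)
  qed
  finally have "exp (- M) \<le> 1 / N ^ 3" .
  then have "(real t)\<^sup>2 * exp (- M) \<le> N\<^sup>2 * (1 / N ^ 3)" using t by (intro mult_mono) auto
  also have "\<dots> = 1 / N" using N by (simp add: power2_eq_square power3_eq_cube)
  finally show ?thesis by (simp add: t_def M_def)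
qed

theorem mainTheorem1:
  fixes f :: "ugraph \<Rightarrow> real" and ft :: "nat \<Rightarrow> real \<Rightarrow> real"
    and c r C :: real and p :: "nat \<Rightarrow> real" and H :: "nat \<Rightarrow> ugraph"
  assumes "minor_monotone f"
    and "\<forall>m q. ft m q \<ge> 0"
    and "c > 1" and "r \<ge> 0"
    and "bounded_below f c r ft"
    and "C \<ge> 10 * c"
    and "\<forall>\<^sub>F n in sequentially. 0 < p n \<and> p n \<le> 2 / real n"
    and "filterlim (\<lambda>n. (real n)\<^sup>2 * p n) at_top sequentially"
    and "\<forall>\<^sub>F n in sequentially. connected_graph (H n) \<and> fst (H n) = {..<n} \<and>
           1 \<le> max_degree (H n) \<and>
           real (max_degree (H n)) \<le> (real n)\<^sup>2 * p n / (9600 * C)"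
  shows "(\<lambda>n. let \<Delta> = real (max_degree (H n));
                  L = 19200 * C * \<Delta>;
                  M = (96 * C * \<Delta>)\<^sup>2 / ((real n)\<^sup>2 * p n);
                  t = nat \<lfloor>(real n)\<^sup>2 * p n / L\<rfloor>
              in measure_pmf.prob (gnp n (p n))
                   {G. f (graph_union (H n) G) \<ge>
                       (if \<Delta> \<le> sqrt ((real n)\<^sup>2 * p n * ln ((real n)\<^sup>2 * p n))
                        then r * ft t (1 - exp (- M))
                        else f (complete_graph t))})
          \<longlonglongrightarrow> 1"
proof -
  note f = assms(1) and c = assms(3) and bb = assms(5) and C = assms(6)
  define N where "N n = (real n)\<^sup>2 * p n" for n
  define \<Delta> where "\<Delta> n = real (max_degree (H n))" for n
  define t where "t n = nat \<lfloor>N n / (19200 * C * \<Delta> n)\<rfloor>" for n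
  define q where "q n = 1 - exp (- ((96 * C * \<Delta> n)\<^sup>2 / N n))" for n
  define x where "x n = (if \<Delta> n \<le> sqrt (N n * ln (N n)) then r * ft (t n) (q n)
    else f (complete_graph (t n)))" for n
  have C10: "10 \<le> C" using c C by linarith
  have N: "filterlim N at_top sequentially" using assms(8) by (simp add: N_def[abs_def])
  have "(\<lambda>n. measure_pmf.prob (gnp n (p n)) {G. x n \<le> f (graph_union (H n) G)}) \<longlonglongrightarrow> 1"
  proof (rule order_tendstoI)
    fix a :: real assume "1 < a"
    then show "\<forall>\<^sub>F n in sequentially.
        measure_pmf.prob (gnp n (p n)) {G. x n \<le> f (graph_union (H n) G)} < a"
      by (intro always_eventually allI le_less_trans[OF measure_pmf.prob_le_1])
  next
    fix a :: real assume "a < 1"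
    \<comment> \<open>The first round and the block graph may each lose \<open>\<epsilon>\<close>,
      and \<open>1 - 2 * \<epsilon>\<close> is the midpoint of \<open>a\<close> and 1.\<close>
    define \<epsilon> where "\<epsilon> = (1 - a) / 4"
    have \<epsilon>: "0 < \<epsilon>" "a < 1 - 2 * \<epsilon>"
      using \<open>a < 1\<close> by (auto simp: \<epsilon>_def field_simps)
    obtain T :: nat where T: "\<And>m q. T \<le> m \<Longrightarrow> c / real m \<le> q \<Longrightarrow> q \<le> 1 \<Longrightarrow>
      1 - \<epsilon> \<le> measure_pmf.prob (gnp m q) {G. r * ft m q \<le> f G}"
      using bounded_below_uniform[OF bb \<epsilon>(1)] by blast
    have "((\<lambda>y::real. exp (- y / 200)) \<longlongrightarrow> 0) at_top" "((\<lambda>y::real. 1 / y) \<longlongrightarrow> 0) at_top"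
      by real_asymp+
    then have "\<forall>\<^sub>F y::real in at_top. exp (- y / 200) < \<epsilon>" "\<forall>\<^sub>F y::real in at_top. 1 / y < \<epsilon>"
      using \<epsilon>(1) by (auto dest: order_tendstoD(2))
    then have large: "\<forall>\<^sub>F n in sequentially. exp (- N n / 200) < \<epsilon>"
        "\<forall>\<^sub>F n in sequentially. 1 / N n < \<epsilon>" "\<forall>\<^sub>F n in sequentially. 1 < N n"
      by (auto intro: eventually_compose_filterlim[OF _ N] eventually_gt_at_top)
    have dens: "\<forall>\<^sub>F n in sequentially. \<forall>D. 1 \<le> D \<longrightarrow> D \<le> sqrt (N n * ln (N n)) \<longrightarrow>
        T \<le> nat \<lfloor>N n / (19200 * C * D)\<rfloor> \<and>
        c / real (nat \<lfloor>N n / (19200 * C * D)\<rfloor>) \<le> 1 - exp (- ((96 * C * D)\<^sup>2 / N n))"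
      by (rule eventually_compose_filterlim[OF eventually_block_density[OF c C] N])
    from large dens assms(7,9)
    show "\<forall>\<^sub>F n in sequentially.
        a < measure_pmf.prob (gnp n (p n)) {G. x n \<le> f (graph_union (H n) G)}"
    proof eventually_elim
      case (elim n)
      have \<Delta>1: "1 \<le> \<Delta> n" using elim by (simp add: \<Delta>_def)
      have q: "0 \<le> q n" "q n \<le> 1" using elim(3) by (auto simp: q_def)
      define P where "P = measure_pmf.prob (gnp (t n) (q n)) {G. x n \<le> f G}"
      have P: "1 - \<epsilon> \<le> P"
      proof (cases "\<Delta> n \<le> sqrt (N n * ln (N n))")
        case True
        then have "T \<le> t n" "c / real (t n) \<le> q n"
          using elim(4) \<Delta>1 by (auto simp: t_def q_def)
        then show ?thesis using T q True by (simp add: P_def x_def)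
      next
        case False
        then have "(real (t n))\<^sup>2 * (1 - q n) \<le> 1 / N n"
          using complete_block_density[OF elim(3) C10 \<Delta>1] by (simp add: t_def q_def)
        then have "1 - \<epsilon> \<le> 1 - (real (t n))\<^sup>2 * (1 - q n)" using elim(2) by linarith
        also have "\<dots> \<le> P"
          using prob_gnp_complete_ge[OF q, of "t n" f] False by (simp add: P_def x_def)
        finally show ?thesis .
      qed
      \<comment> \<open>As \<open>P\<close> is at most 1, the product of the two probabilities is at
        least \<open>P - exp (- N n / 200)\<close>.\<close>
      have "exp (- N n / 200) * P \<le> exp (- N n / 200) * 1"
        unfolding P_def by (intro mult_left_mono) auto
      then have "a < (1 - exp (- N n / 200)) * P"
        using P elim(1) \<epsilon>(2) unfolding left_diff_distrib by linarith
      also have "\<dots> \<le> measure_pmf.prob (gnp n (p n)) {G. x n \<le> f (graph_union (H n) G)}"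
        using prob_gnp_union_ge[OF f _ _ refl _ _ C10, of "H n" n "p n" "x n"] elim(5,6)
        by (simp add: P_def t_def q_def N_def \<Delta>_def)
      finally show ?case .
    qed
  qed
  then show ?thesis
    unfolding Let_def x_def t_def q_def N_def \<Delta>_def .
qed

end
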